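(* Let $C$ be an S-minimal tetrahedral curve defined by $(a_1,a_2,a_3,a_4,a_5,a_6)$. Then $C$ is arithmetically Buchsbaum and not arithmetically Cohen-Macaulay if and only if there are integers $i\ne j$ in $\{1,2,3\}$ such that \[ a_i+1=a_j=a_{7-j}=a_{7-i}+1 \] and the two remaining weights are zero.
   Context: Let $k$ be a field and $R=k[a,b,c,d]$. For integers $a_1,\dots,a_6\ge0$ (the weights), the tetrahedral curve defined by $(a_1,\dots,a_6)$ is the subscheme $C$ of $\mathbb P^3$ with saturated ideal $(a,b)^{a_1}\cap(a,c)^{a_2}\cap(a,d)^{a_3}\cap(b,c)^{a_4}\cap(b,d)^{a_5}\cap(c,d)^{a_6}$. Let $M(C)=\bigoplus_{j}H^1(\mathbb P^3,\mathcal I_C(j))$ be its Hartshorne-Rao module. $C$ is arithmetically Cohen-Macaulay if $M(C)=0$ (the trivial curve $(0,\dots,0)$ included), and arithmetically Buchsbaum if its homogeneous coordinate ring is Buchsbaum, equivalently $(a,b,c,d)\cdot M(C)=0$. S-minimality. For a tetrahedral curve with not all $a_i$ zero consider the systems (A): $a_1+a_2\ge a_4$, $a_1+a_3\ge a_5$, $a_2+a_3\ge a_6$; (B): $a_1+a_4\ge a_2$, $a_1+a_5\ge a_3$, $a_4+a_5\ge a_6$; (C): $a_2+a_4\ge a_1$, $a_2+a_6\ge a_3$, $a_4+a_6\ge a_5$; (D): $a_3+a_5\ge a_1$, $a_3+a_6\ge a_2$, $a_5+a_6\ge a_4$. A tetrahedral curve is S-minimal if it is trivial or none of the systems (A), (B),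 (C), (D) holds. *)

theory Defs
  imports
    Complex_Main
    "HOL-Library.Poly_Mapping"
    "HOL-Library.Numeral_Type"
    "HOL-Computational_Algebra.Fraction_Field"
begin

text \<open>
  The ring \<open>R = k[a,b,c,d]\<close> is the monoid algebra over \<open>k\<close> of the exponent vectors
  \<open>4 \<Rightarrow>\<^sub>0 nat\<close>; the indeterminates \<open>a, b, c, d\<close> are \<open>var 0, var 1, var 2, var 3\<close>.
  All its localizations live in the fraction field.
\<close>

type_synonym 'k ring4 = "(4 \<Rightarrow>\<^sub>0 nat) \<Rightarrow>\<^sub>0 'k"

definition var :: "4 \<Rightarrow> 'k::field ring4" where
  "var v = Poly_Mapping.single (Poly_Mapping.single v 1) 1"

text \<open>The degree is an integer because twists by negative integers occur;
  \<open>0\<close> is homogeneous of every degree.\<close>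

definition homogeneous :: "int \<Rightarrow> 'k::field ring4 \<Rightarrow> bool" where
  "homogeneous d f \<longleftrightarrow>
     (\<forall>m \<in> Poly_Mapping.keys f. int (\<Sum>v\<in>UNIV. Poly_Mapping.lookup m v) = d)"

definition ideal_gen :: "'r::comm_ring_1 set \<Rightarrow> 'r set" where
  "ideal_gen S = module.span (*) S"

fun ideal_power :: "'r::comm_ring_1 set \<Rightarrow> nat \<Rightarrow> 'r set" where
  "ideal_power I 0 = UNIV"
| "ideal_power I (Suc n) = ideal_gen {x * y | x y. x \<in> I \<and> y \<in> ideal_power I n}"

text \<open>Weights are functions on \<open>nat\<close> of which only the values at \<open>1, \<dots>, 6\<close> matter.\<close>

definition tetrahedral_ideal :: "(nat \<Rightarrow> nat) \<Rightarrow> 'k::field ring4 set" where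
  "tetrahedral_ideal w =
     ideal_power (ideal_gen {var 0, var 1}) (w 1) \<inter>
     ideal_power (ideal_gen {var 0, var 2}) (w 2) \<inter>
     ideal_power (ideal_gen {var 0, var 3}) (w 3) \<inter>
     ideal_power (ideal_gen {var 1, var 2}) (w 4) \<inter>
     ideal_power (ideal_gen {var 1, var 3}) (w 5) \<inter>
     ideal_power (ideal_gen {var 2, var 3}) (w 6)"

text \<open>
  For a homogeneous ideal \<open>I\<close> with associated ideal sheaf \<open>\<I>\<close> on \<open>\<bbbP>\<^sup>3\<close>, and a nonempty set \<open>\<sigma>\<close> of
  indeterminates with product \<open>x\<close>, the sections of \<open>\<I>(j)\<close> over the affine open set \<open>D\<^sub>+(x)\<close> are the
  elements of degree \<open>j\<close> of the localization \<open>I\<^sub>x\<close>. Every such element is \<open>f / x^n\<close> with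
  \<open>f \<in> I\<close> homogeneous of degree \<open>j + n deg x\<close>.
\<close>

definition sections :: "'k::field ring4 set \<Rightarrow> int \<Rightarrow> 4 set \<Rightarrow> 'k ring4 fract set" where
  "sections I j \<sigma> =
     {Fract f ((\<Prod>v\<in>\<sigma>. var v) ^ n) | f n. f \<in> I \<and> homogeneous (j + int n * int (card \<sigma>)) f}"

text \<open>
  \<open>H\<^sup>1(\<bbbP>\<^sup>3, \<I>(j))\<close> is the Cech cohomology of \<open>\<I>(j)\<close> with respect to the standard affine cover
  \<open>D\<^sub>+(a), \<dots>, D\<^sub>+(d)\<close>, computed with the complex of all (not only the alternating) cochains.
\<close>

type_synonym 'k cochain1 = "4 \<Rightarrow> 4 \<Rightarrow> 'k ring4 fract"

definition cocycles1 :: "'k::field ring4 set \<Rightarrow> int \<Rightarrow> 'k cochain1 set" where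
  "cocycles1 I j =
     {t. (\<forall>p q. t p q \<in> sections I j {p, q}) \<and> (\<forall>p q r. t q r - t p r + t p q = 0)}"

definition coboundaries1 :: "'k::field ring4 set \<Rightarrow> int \<Rightarrow> 'k cochain1 set" where
  "coboundaries1 I j = {\<lambda>p q. s q - s p | s. \<forall>p. s p \<in> sections I j {p}}"

definition cohomologous :: "'k::field ring4 set \<Rightarrow> int \<Rightarrow> ('k cochain1 \<times> 'k cochain1) set" where
  "cohomologous I j =
     {(t, u). t \<in> cocycles1 I j \<and> u \<in> cocycles1 I j \<and> (\<lambda>p q. t p q - u p q) \<in> coboundaries1 I j}"

definition H1 :: "'k::field ring4 set \<Rightarrow> int \<Rightarrow> 'k cochain1 set set" where
  "H1 I j = cocycles1 I j // cohomologous I j"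

definition H1_zero :: "'k::field ring4 set \<Rightarrow> int \<Rightarrow> 'k cochain1 set" where
  "H1_zero I j = cohomologous I j `` {\<lambda>p q. 0}"

text \<open>Multiplication by an indeterminate, from \<open>H\<^sup>1(\<I>(j))\<close> to \<open>H\<^sup>1(\<I>(j + 1))\<close>.\<close>

definition H1_mult ::
    "'k::field ring4 set \<Rightarrow> int \<Rightarrow> 4 \<Rightarrow> 'k cochain1 set \<Rightarrow> 'k cochain1 set" where
  "H1_mult I j v \<xi> = (\<Union>t\<in>\<xi>. cohomologous I (j + 1) `` {\<lambda>p q. Fract (var v) 1 * t p q})"

text \<open>The Hartshorne-Rao module, the direct sum of the \<open>H\<^sup>1(\<I>(j))\<close> over all integers \<open>j\<close>.\<close>

definition rao_module :: "'k::field ring4 set \<Rightarrow> (int \<Rightarrow> 'k cochain1 set) set" where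
  "rao_module I = {m. (\<forall>j. m j \<in> H1 I j) \<and> finite {j. m j \<noteq> H1_zero I j}}"

definition rao_zero :: "'k::field ring4 set \<Rightarrow> int \<Rightarrow> 'k cochain1 set" where
  "rao_zero I = (\<lambda>j. H1_zero I j)"

definition rao_mult ::
    "'k::field ring4 set \<Rightarrow> 4 \<Rightarrow> (int \<Rightarrow> 'k cochain1 set) \<Rightarrow> int \<Rightarrow> 'k cochain1 set" where
  "rao_mult I v m = (\<lambda>j. H1_mult I (j - 1) v (m (j - 1)))"

text \<open>A curve is given by its saturated homogeneous ideal.\<close>

definition arithmetically_CM :: "'k::field ring4 set \<Rightarrow> bool" where
  "arithmetically_CM I \<longleftrightarrow> rao_module I = {rao_zero I}"

text \<open>\<open>(a,b,c,d) \<cdot> M(C) = 0\<close>, tested on the generators \<open>a, b, c, d\<close> of the ideal.\<close>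

definition arithmetically_Buchsbaum :: "'k::field ring4 set \<Rightarrow> bool" where
  "arithmetically_Buchsbaum I \<longleftrightarrow> (\<forall>v. \<forall>m \<in> rao_module I. rao_mult I v m = rao_zero I)"

definition system_A :: "(nat \<Rightarrow> nat) \<Rightarrow> bool" where
  "system_A w \<longleftrightarrow> w 1 + w 2 \<ge> w 4 \<and> w 1 + w 3 \<ge> w 5 \<and> w 2 + w 3 \<ge> w 6"

definition system_B :: "(nat \<Rightarrow> nat) \<Rightarrow> bool" where
  "system_B w \<longleftrightarrow> w 1 + w 4 \<ge> w 2 \<and> w 1 + w 5 \<ge> w 3 \<and> w 4 + w 5 \<ge> w 6"

definition system_C :: "(nat \<Rightarrow> nat) \<Rightarrow> bool" where
  "system_C w \<longleftrightarrow> w 2 + w 4 \<ge> w 1 \<and> w 2 + w 6 \<ge> w 3 \<and> w 4 + w 6 \<ge> w 5"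

definition system_D :: "(nat \<Rightarrow> nat) \<Rightarrow> bool" where
  "system_D w \<longleftrightarrow> w 3 + w 5 \<ge> w 1 \<and> w 3 + w 6 \<ge> w 2 \<and> w 5 + w 6 \<ge> w 4"

definition S_minimal :: "(nat \<Rightarrow> nat) \<Rightarrow> bool" where
  "S_minimal w \<longleftrightarrow>
     (\<forall>i\<in>{1..6}. w i = 0) \<or>
     \<not> system_A w \<and> \<not> system_B w \<and> \<not> system_C w \<and> \<not> system_D w"

end

theory Submission
  imports Defs
begin

text \<open>
  The ideal is monomial, so its first cohomology decomposes over the multidegrees \<open>\<alpha> \<in> \<int>\<^sup>4\<close>.
  In multidegree \<open>\<alpha>\<close> it is the reduced zeroth cohomology of a graph, one-dimensional if
  \<open>\<alpha>\<close> is nonnegative and the edges \<open>pq\<close> of the tetrahedron with \<open>\<alpha>\<^sub>p + \<alpha>\<^sub>q\<close> below the weight of \<open>pq\<close>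
  are exactly two opposite ones, and zero otherwise. Multiplication by an indeterminate is an isomorphism
  between two adjacent multidegrees of this kind. So the curve is arithmetically Cohen-Macaulay iff no
  such multidegree exists, and arithmetically Buchsbaum iff no two of them are adjacent. What is left
  is linear arithmetic: isolation makes the two violated inequalities fail by exactly one, and
  S-minimality then leaves only the stated weights.
\<close>

text \<open>Fix \<alpha>. A section over the chart of a vertex set \<sigma> can have a term of
  multidegree \<alpha> exactly when the coordinates and edges lying outside \<sigma> satisfy their
  inequalities; call \<sigma> forbidden otherwise. A cocycle in multidegree \<alpha> is a potential
  on the four vertices, up to a constant, that agrees at the ends of every forbidden pair. It is a
  coboundary iff some shift makes it vanish at all forbidden vertices. So the graph has the
  forbidden vertices as vertices and the forbidden pairs as edges. For nonnegative \<alpha>, a pair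
  is forbidden iff the opposite edge is violated, and a vertex is forbidden iff it lies on a
  forbidden pair. Hence no vertex is isolated, and on at most four vertices such a graph is
  disconnected only if it is a perfect matching. A negative coordinate at v makes the other three
  vertices a triangle, to which v, if forbidden, is joined. Laurent polynomials have finite support,
  so the potentials chosen separately for each \<alpha> must be zero wherever the cocycle is
  zero.\<close>

lemma module_mult: "module ((*) :: 'a::comm_ring_1 \<Rightarrow> 'a \<Rightarrow> 'a)"
  by unfold_locales (simp_all add: algebra_simps)

section \<open>Membership in the tetrahedral ideal, monomial by monomial\<close>

lemma sum_single_keys: "(\<Sum>m\<in>Poly_Mapping.keys f. Poly_Mapping.single m (Poly_Mapping.lookup f m)) = f"
proof (rule poly_mapping_eqI)
  fix k
  have "(\<Sum>m\<in>Poly_Mapping.keys f. Poly_Mapping.lookup (Poly_Mapping.single m (Poly_Mapping.lookup f m)) k)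
      = (\<Sum>m\<in>Poly_Mapping.keys f. if m = k then Poly_Mapping.lookup f k else 0)"
    by (rule sum.cong) (auto simp: lookup_single)
  also have "\<dots> = Poly_Mapping.lookup f k"
    by (simp add: sum.delta in_keys_iff)
  finally show "Poly_Mapping.lookup (\<Sum>m\<in>Poly_Mapping.keys f. Poly_Mapping.single m (Poly_Mapping.lookup f m)) k
      = Poly_Mapping.lookup f k"
    by (simp add: lookup_sum)
qed

text \<open>Multiplication can only add exponents, so for additive \<open>D\<close> the polynomials
  all of whose monomials have \<open>D\<close> at least \<open>n\<close> form an ideal. This serves
  for the ideal of a line (with \<open>n = 1\<close>) and again in the induction on its
  powers.\<close>

lemma ideal_gen_keys_ge:
  fixes D :: "(4 \<Rightarrow>\<^sub>0 nat) \<Rightarrow> nat" and S :: "'k::field ring4 set"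
  assumes add: "\<And>a b. D (a + b) = D a + D b"
    and S: "\<And>x m. x \<in> S \<Longrightarrow> m \<in> Poly_Mapping.keys x \<Longrightarrow> n \<le> D m"
    and f: "f \<in> ideal_gen S" and m: "m \<in> Poly_Mapping.keys f"
  shows "n \<le> D m"
proof -
  let ?T = "{x :: 'k ring4. \<forall>m\<in>Poly_Mapping.keys x. n \<le> D m}"
  have "module.subspace (*) ?T"
  proof (rule module.subspaceI[OF module_mult])
    show "x + y \<in> ?T" if "x \<in> ?T" "y \<in> ?T" for x y
      using that keys_add[of x y] by blast
    show "c * x \<in> ?T" if "x \<in> ?T" for c x
    proof safe
      fix m assume "m \<in> Poly_Mapping.keys (c * x)"
      then obtain a b where "m = a + b" "b \<in> Poly_Mapping.keys x"
        using keys_mult[of c x] by blast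
      then show "n \<le> D m"
        using that add[of a b] by (simp add: trans_le_add2)
    qed
  qed simp
  then have "module.span (*) S \<subseteq> ?T"
    using S by (intro module.span_minimal[OF module_mult]) auto
  then show ?thesis
    using f m by (auto simp: ideal_gen_def)
qed

lemma lookup_single_one:
  "Poly_Mapping.lookup (Poly_Mapping.single p (1::nat)) v = (if v = p then 1 else 0)"
  "Poly_Mapping.lookup (Poly_Mapping.single p (Suc 0)) v = (if v = p then 1 else 0)"
  by (simp_all add: lookup_single when_def)

lemma ideal_power_pair_iff:
  fixes f :: "'k::field ring4"
  assumes "p \<noteq> q"
  shows "f \<in> ideal_power (ideal_gen {var p, var q}) n \<longleftrightarrow>
    (\<forall>m\<in>Poly_Mapping.keys f. n \<le> Poly_Mapping.lookup m p + Poly_Mapping.lookup m q)"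
proof -
  define D :: "(4 \<Rightarrow>\<^sub>0 nat) \<Rightarrow> nat"
    where "D m = Poly_Mapping.lookup m p + Poly_Mapping.lookup m q" for m
  have add: "D (a + b) = D a + D b" for a b
    by (simp add: D_def lookup_add)
  let ?I = "ideal_gen {var p, var q} :: 'k ring4 set"
  have I: "1 \<le> D m" if "x \<in> ?I" "m \<in> Poly_Mapping.keys x" for x m
    using add _ that
    by (rule ideal_gen_keys_ge) (auto simp: var_def D_def lookup_single_one split: if_splits)
  have "f \<in> ideal_power ?I n \<longleftrightarrow> (\<forall>m\<in>Poly_Mapping.keys f. n \<le> D m)"
  proof (induction n arbitrary: f)
    case (Suc n)
    let ?S = "{x * y | x y. x \<in> ?I \<and> y \<in> ideal_power ?I n}"
    show ?case
    proof
      assume f: "f \<in> ideal_power ?I (Suc n)"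
      have "Suc n \<le> D m" if "m \<in> Poly_Mapping.keys f" for m
      proof (rule ideal_gen_keys_ge[where D = D and S = ?S, OF add _ _ that])
        show "f \<in> ideal_gen ?S"
          using f by simp
        show "Suc n \<le> D m" if z: "z \<in> ?S" and m: "m \<in> Poly_Mapping.keys z" for z m
        proof -
          obtain x y where z: "z = x * y" "x \<in> ?I" "y \<in> ideal_power ?I n"
            using z by blast
          then obtain a b where "m = a + b" "a \<in> Poly_Mapping.keys x" "b \<in> Poly_Mapping.keys y"
            using m keys_mult[of x y] by blast
          then have "1 \<le> D a" "n \<le> D b" "D m = D a + D b"
            using I z Suc.IH add by auto
          then show ?thesis by simp
        qed
      qed
      then show "\<forall>m\<in>Poly_Mapping.keys f. Suc n \<le> D m" by blast
    next
      assume f: "\<forall>m\<in>Poly_Mapping.keys f. Suc n \<le> D m"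
      have "Poly_Mapping.single m (Poly_Mapping.lookup f m) \<in> module.span (*) ?S"
        if m: "m \<in> Poly_Mapping.keys f" for m
      proof -
        have "Suc n \<le> D m" using f m by blast
        then have "1 \<le> Poly_Mapping.lookup m p \<or> 1 \<le> Poly_Mapping.lookup m q"
          unfolding D_def by arith
        then obtain v where v: "v \<in> {p, q}" "1 \<le> Poly_Mapping.lookup m v"
          by blast
        define m' where "m' = m - Poly_Mapping.single v 1"
        have m': "m = Poly_Mapping.single v 1 + m'"
          using v by (intro poly_mapping_eqI) (simp add: m'_def lookup_add lookup_minus lookup_single_one)
        \<comment> \<open>Since p \<noteq> q, splitting off one indeterminate costs exactly one unit
          of \<open>D\<close>, so the remaining monomial still lies in the n-th power.\<close>
        have "D (Poly_Mapping.single v 1) = 1"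
          using v assms by (auto simp: D_def lookup_single_one)
        then have "n \<le> D m'"
          using \<open>Suc n \<le> D m\<close> add[of "Poly_Mapping.single v 1" m'] m' by simp
        then have "Poly_Mapping.single m' (Poly_Mapping.lookup f m) \<in> ideal_power ?I n"
          by (simp add: Suc.IH)
        moreover have "var v \<in> ?I"
          using v unfolding ideal_gen_def by (intro module.span_base[OF module_mult]) auto
        moreover have "Poly_Mapping.single m (Poly_Mapping.lookup f m)
            = var v * Poly_Mapping.single m' (Poly_Mapping.lookup f m)"
          unfolding var_def mult_single m'[symmetric] by simp
        ultimately show ?thesis
          by (intro module.span_base[OF module_mult]) blast
      qed
      then have "(\<Sum>m\<in>Poly_Mapping.keys f. Poly_Mapping.single m (Poly_Mapping.lookup f m))
          \<in> module.span (*) ?S"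
        by (intro module.span_sum[OF module_mult])
      then show "f \<in> ideal_power ?I (Suc n)"
        by (simp add: sum_single_keys ideal_gen_def)
    qed
  qed simp
  then show ?thesis by (simp add: D_def)
qed

text \<open>A symmetric form of the six weights, so that the vertices can be relabelled freely. With
  0 on the diagonal, the case p = q of a condition quantified over all p and q demands nothing
  beyond nonnegativity.\<close>

definition edge_weight :: "(nat \<Rightarrow> nat) \<Rightarrow> 4 \<Rightarrow> 4 \<Rightarrow> nat" where
  "edge_weight w p q =
     (if {p, q} = {0, 1} then w 1 else if {p, q} = {0, 2} then w 2
      else if {p, q} = {0, 3} then w 3 else if {p, q} = {1, 2} then w 4
      else if {p, q} = {1, 3} then w 5 else if {p, q} = {2, 3} then w 6 else 0)"

lemma edge_weight_commute: "edge_weight w p q = edge_weight w q p"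
  by (simp add: edge_weight_def insert_commute)

lemma UNIV_4: "(UNIV :: 4 set) = {0, 1, 2, 3}"
proof -
  have "card {0, 1, 2, 3 :: 4} = card (UNIV :: 4 set)" by simp
  then show ?thesis by (metis card_subset_eq finite subset_UNIV)
qed

lemma edge_weight_simps:
  "edge_weight w 0 1 = w 1" "edge_weight w 0 2 = w 2" "edge_weight w 0 3 = w 3"
  "edge_weight w 1 2 = w 4" "edge_weight w 1 3 = w 5" "edge_weight w 2 3 = w 6"
  "edge_weight w 1 0 = w 1" "edge_weight w 2 0 = w 2" "edge_weight w 3 0 = w 3"
  "edge_weight w 2 1 = w 4" "edge_weight w 3 1 = w 5" "edge_weight w 3 2 = w 6"
  "edge_weight w p p = 0"
  by (simp_all add: edge_weight_def doubleton_eq_iff) auto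

lemma tetrahedral_ideal_iff:
  fixes f :: "'k::field ring4"
  shows "f \<in> tetrahedral_ideal w \<longleftrightarrow>
    (\<forall>m\<in>Poly_Mapping.keys f. \<forall>p q.
       edge_weight w p q \<le> Poly_Mapping.lookup m p + Poly_Mapping.lookup m q)"
proof -
  have "f \<in> tetrahedral_ideal w \<longleftrightarrow> (\<forall>m\<in>Poly_Mapping.keys f. \<forall>p\<in>{0,1,2,3}. \<forall>q\<in>{0,1,2,3}.
       edge_weight w p q \<le> Poly_Mapping.lookup m p + Poly_Mapping.lookup m q)"
    by (simp add: tetrahedral_ideal_def ideal_power_pair_iff edge_weight_simps add.commute
        ball_conj_distrib) blast
  then show ?thesis by (simp add: UNIV_4[symmetric])
qed

section \<open>Coefficient functions of polynomials and Laurent polynomials\<close>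

definition exps :: "(4 \<Rightarrow>\<^sub>0 nat) \<Rightarrow> 4 \<Rightarrow> int" where
  "exps m v = int (Poly_Mapping.lookup m v)"

text \<open>Coefficients are indexed by integer vectors, so that multiplication by a monomial is a
  shift without side conditions.\<close>

definition coeff_at :: "'k::field ring4 \<Rightarrow> (4 \<Rightarrow> int) \<Rightarrow> 'k" where
  "coeff_at f \<alpha> = (if \<forall>v. 0 \<le> \<alpha> v then Poly_Mapping.lookup f (Abs_poly_mapping (\<lambda>v. nat (\<alpha> v))) else 0)"

lemma exps_inject: "exps m = exps n \<longleftrightarrow> m = n"
  by (auto simp: exps_def fun_eq_iff intro: poly_mapping_eqI)

lemma exps_add: "exps (m + n) = (\<lambda>v. exps m v + exps n v)"
  by (simp add: exps_def fun_eq_iff lookup_add)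

lemma coeff_at_exps: "coeff_at f (exps m) = Poly_Mapping.lookup f m"
proof -
  have "Abs_poly_mapping (\<lambda>v. nat (exps m v)) = m"
    by (rule poly_mapping_eqI) (simp add: exps_def)
  then show ?thesis
    by (simp add: coeff_at_def exps_def)
qed

lemma nonneg_exps: "(\<forall>v. 0 \<le> \<alpha> v) \<longleftrightarrow> (\<exists>m. \<alpha> = exps m)"
proof
  assume "\<forall>v. 0 \<le> \<alpha> v"
  then have "\<alpha> = exps (Abs_poly_mapping (\<lambda>v. nat (\<alpha> v)))"
    by (simp add: exps_def fun_eq_iff)
  then show "\<exists>m. \<alpha> = exps m" by blast
qed (auto simp: exps_def)

lemma coeff_at_neg: "\<not> (\<forall>v. 0 \<le> \<alpha> v) \<Longrightarrow> coeff_at f \<alpha> = 0"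
  by (simp only: coeff_at_def if_False)

lemma coeff_at_nonzero: "coeff_at f \<alpha> \<noteq> 0 \<longleftrightarrow> (\<exists>m\<in>Poly_Mapping.keys f. \<alpha> = exps m)"
  using coeff_at_neg[of \<alpha> f] nonneg_exps[of \<alpha>] by (auto simp: coeff_at_exps in_keys_iff)

lemma coeff_at_inject: "coeff_at f = coeff_at g \<longleftrightarrow> f = g"
  by (metis coeff_at_exps poly_mapping_eqI)

lemma coeff_at_diff: "coeff_at (f - g) \<alpha> = coeff_at f \<alpha> - coeff_at g \<alpha>"
  by (simp add: coeff_at_def lookup_minus)

lemma coeff_at_sum:
  fixes f :: "'b \<Rightarrow> 'a::field ring4"
  shows "coeff_at (\<Sum>x\<in>A. f x) \<alpha> = (\<Sum>x\<in>A. coeff_at (f x) \<alpha>)"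
proof (cases "\<forall>v. 0 \<le> \<alpha> v")
  case True
  then show ?thesis by (simp add: coeff_at_def lookup_sum)
next
  case False
  then have "coeff_at g \<alpha> = 0" for g :: "'a ring4"
    by (rule coeff_at_neg)
  then show ?thesis by simp
qed

lemma coeff_at_zero: "coeff_at 0 \<alpha> = 0"
  by (simp add: coeff_at_def)

lemma coeff_at_single: "coeff_at (Poly_Mapping.single m a) \<alpha> = (if \<alpha> = exps m then a else 0)"
proof (cases "\<exists>n. \<alpha> = exps n")
  case True
  then show ?thesis
    by (auto simp: coeff_at_exps exps_inject lookup_single when_def)
next
  case False
  then show ?thesis
    using nonneg_exps coeff_at_neg by metis
qed

lemma coeff_at_single_mult:
  "coeff_at (Poly_Mapping.single m a * f) \<alpha> = a * coeff_at f (\<lambda>v. \<alpha> v - exps m v)"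
proof -
  have "coeff_at (Poly_Mapping.single m a * Poly_Mapping.single k b) \<alpha>
      = a * coeff_at (Poly_Mapping.single k b) (\<lambda>v. \<alpha> v - exps m v)" for k b
    by (auto simp: mult_single coeff_at_single exps_add fun_eq_iff algebra_simps)
  then have "coeff_at (Poly_Mapping.single m a *
        (\<Sum>k\<in>Poly_Mapping.keys f. Poly_Mapping.single k (Poly_Mapping.lookup f k))) \<alpha>
      = a * coeff_at (\<Sum>k\<in>Poly_Mapping.keys f. Poly_Mapping.single k (Poly_Mapping.lookup f k))
          (\<lambda>v. \<alpha> v - exps m v)"
    by (simp add: sum_distrib_left coeff_at_sum)
  then show ?thesis
    by (simp add: sum_single_keys)
qed

lemma coeff_at_exists:
  assumes "finite {\<alpha>. c \<alpha> \<noteq> 0}" and "\<And>\<alpha>. c \<alpha> \<noteq> 0 \<Longrightarrow> \<forall>v. 0 \<le> \<alpha> v"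
  shows "\<exists>f. coeff_at f = c"
proof -
  define f where "f = Abs_poly_mapping (\<lambda>m. c (exps m))"
  have "finite {m. c (exps m) \<noteq> 0}"
    using finite_vimageI[OF assms(1), of exps] by (simp add: vimage_def inj_def exps_inject)
  then have f: "Poly_Mapping.lookup f m = c (exps m)" for m
    by (simp add: f_def)
  have "coeff_at f \<alpha> = c \<alpha>" for \<alpha>
    using nonneg_exps[of \<alpha>] assms(2)[of \<alpha>] coeff_at_neg[of \<alpha> f] by (auto simp: coeff_at_exps f)
  then show ?thesis by blast
qed

text \<open>The coefficient function of an element of \<open>k[a,b,c,d,1/a,1/b,1/c,1/d]\<close>.\<close>

definition laurent :: "'k::field ring4 fract \<Rightarrow> ((4 \<Rightarrow> int) \<Rightarrow> 'k) \<Rightarrow> bool" where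
  "laurent z c \<longleftrightarrow> (\<exists>f m. z = Fract f (Poly_Mapping.single m 1) \<and>
     c = (\<lambda>\<alpha>. coeff_at f (\<lambda>v. \<alpha> v + exps m v)))"

lemma laurentI:
  "laurent (Fract f (Poly_Mapping.single m 1)) (\<lambda>\<alpha>. coeff_at f (\<lambda>v. \<alpha> v + exps m v))"
  by (auto simp: laurent_def)

lemma single_one_nonzero: "Poly_Mapping.single m (1::'k::field) \<noteq> 0"
  by (metis lookup_single_eq lookup_zero one_neq_zero)

text \<open>Both directions are used: coefficients do not depend on the fraction chosen for an
  element, and they determine the element. Cross-multiplication by the monomial denominators yields
  an equality of polynomials, whose coefficient equations are those of \<open>c = d\<close> up to a
  shift of the index.\<close>

lemma laurent_inject:
  assumes "laurent z c" "laurent y d"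
  shows "z = y \<longleftrightarrow> c = d"
proof -
  obtain f m where z: "z = Fract f (Poly_Mapping.single m 1)"
    and c: "c = (\<lambda>\<alpha>. coeff_at f (\<lambda>v. \<alpha> v + exps m v))"
    using assms(1) by (auto simp: laurent_def)
  obtain g n where y: "y = Fract g (Poly_Mapping.single n 1)"
    and d: "d = (\<lambda>\<alpha>. coeff_at g (\<lambda>v. \<alpha> v + exps n v))"
    using assms(2) by (auto simp: laurent_def)
  have "z = y \<longleftrightarrow> Poly_Mapping.single n 1 * f = Poly_Mapping.single m 1 * g"
    unfolding z y by (simp add: eq_fract single_one_nonzero mult.commute)
  also have "\<dots> \<longleftrightarrow> (\<forall>\<alpha>. coeff_at f (\<lambda>v. \<alpha> v - exps n v) = coeff_at g (\<lambda>v. \<alpha> v - exps m v))"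
    unfolding coeff_at_inject[symmetric] by (simp add: fun_eq_iff coeff_at_single_mult)
  also have "\<dots> \<longleftrightarrow> c = d"
  proof
    assume eq: "\<forall>\<alpha>. coeff_at f (\<lambda>v. \<alpha> v - exps n v) = coeff_at g (\<lambda>v. \<alpha> v - exps m v)"
    show "c = d"
    proof
      fix \<alpha>
      show "c \<alpha> = d \<alpha>"
        using eq[rule_format, of "\<lambda>v. \<alpha> v + exps m v + exps n v"] by (simp add: c d add.commute add.left_commute)
    qed
  next
    assume "c = d"
    show "\<forall>\<alpha>. coeff_at f (\<lambda>v. \<alpha> v - exps n v) = coeff_at g (\<lambda>v. \<alpha> v - exps m v)"
    proof
      fix \<alpha>
      have "c (\<lambda>v. \<alpha> v - exps m v - exps n v) = d (\<lambda>v. \<alpha> v - exps m v - exps n v)"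
        using \<open>c = d\<close> by simp
      then show "coeff_at f (\<lambda>v. \<alpha> v - exps n v) = coeff_at g (\<lambda>v. \<alpha> v - exps m v)"
        by (simp add: c d algebra_simps)
    qed
  qed
  finally show ?thesis .
qed

lemma laurent_zero: "laurent 0 (\<lambda>\<alpha>. 0)"
proof -
  have "laurent (Fract 0 (Poly_Mapping.single 0 1)) (\<lambda>\<alpha>. coeff_at 0 (\<lambda>v. \<alpha> v + exps 0 v))"
    by (rule laurentI)
  then show ?thesis
    by (simp add: coeff_at_zero fract_collapse)
qed

lemma laurent_diff:
  assumes "laurent z c" "laurent y d"
  shows "laurent (z - y) (\<lambda>\<alpha>. c \<alpha> - d \<alpha>)"
proof -
  obtain f m where z: "z = Fract f (Poly_Mapping.single m 1)"
    and c: "c = (\<lambda>\<alpha>. coeff_at f (\<lambda>v. \<alpha> v + exps m v))"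
    using assms(1) by (auto simp: laurent_def)
  obtain g n where y: "y = Fract g (Poly_Mapping.single n 1)"
    and d: "d = (\<lambda>\<alpha>. coeff_at g (\<lambda>v. \<alpha> v + exps n v))"
    using assms(2) by (auto simp: laurent_def)
  have "z - y = Fract (Poly_Mapping.single n 1 * f - Poly_Mapping.single m 1 * g) (Poly_Mapping.single (m + n) 1)"
    unfolding z y by (simp add: single_one_nonzero mult.commute mult_single)
  moreover have "(\<lambda>\<alpha>. c \<alpha> - d \<alpha>) = (\<lambda>\<alpha>. coeff_at (Poly_Mapping.single n 1 * f - Poly_Mapping.single m 1 * g)
      (\<lambda>v. \<alpha> v + exps (m + n) v))"
    by (simp add: fun_eq_iff c d coeff_at_diff coeff_at_single_mult exps_add)
  ultimately show ?thesis
    unfolding laurent_def by blast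
qed

lemma laurent_var_mult:
  assumes "laurent z c"
  shows "laurent (Fract (var v) 1 * z) (\<lambda>\<alpha>. c (\<alpha>(v := \<alpha> v - 1)))"
proof -
  obtain f m where z: "z = Fract f (Poly_Mapping.single m 1)"
    and c: "c = (\<lambda>\<alpha>. coeff_at f (\<lambda>v. \<alpha> v + exps m v))"
    using assms by (auto simp: laurent_def)
  have "(\<lambda>u. (\<alpha>(v := \<alpha> v - 1)) u + exps m u) = (\<lambda>u. \<alpha> u + exps m u - exps (Poly_Mapping.single v 1) u)" for \<alpha>
    by (simp add: fun_eq_iff exps_def lookup_single_one)
  then show ?thesis
    using laurentI[of "var v * f" m] by (simp add: z c var_def coeff_at_single_mult)
qed

lemma laurent_finite:
  assumes "laurent z c"
  shows "finite {\<alpha>. c \<alpha> \<noteq> 0}"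
proof -
  obtain f m where c: "c = (\<lambda>\<alpha>. coeff_at f (\<lambda>v. \<alpha> v + exps m v))"
    using assms by (auto simp: laurent_def)
  have "{\<alpha>. c \<alpha> \<noteq> 0} \<subseteq> (\<lambda>k v. exps k v - exps m v) ` Poly_Mapping.keys f"
  proof
    fix \<alpha> assume "\<alpha> \<in> {\<alpha>. c \<alpha> \<noteq> 0}"
    then obtain k where k: "k \<in> Poly_Mapping.keys f" "(\<lambda>v. \<alpha> v + exps m v) = exps k"
      by (auto simp: c coeff_at_nonzero)
    then have "\<alpha> = (\<lambda>v. exps k v - exps m v)"
      by (metis (no_types) add_diff_cancel_right' ext)
    then show "\<alpha> \<in> (\<lambda>k v. exps k v - exps m v) ` Poly_Mapping.keys f"
      using k by blast
  qed
  then show ?thesis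
    by (rule finite_subset) simp
qed

text \<open>The denominator is prescribed because \<open>sections\<close> asks for a power of one
  particular product. The last clause gives the coefficients of the numerator, from which ideal
  membership and homogeneity can be read off.\<close>

lemma laurent_exists_denominator:
  assumes "finite {\<alpha>. c \<alpha> \<noteq> 0}" and "\<And>\<alpha> v. c \<alpha> \<noteq> 0 \<Longrightarrow> 0 \<le> \<alpha> v + exps m v"
  shows "\<exists>f. laurent (Fract f (Poly_Mapping.single m 1)) c \<and> (\<forall>\<alpha>. coeff_at f \<alpha> = c (\<lambda>v. \<alpha> v - exps m v))"
proof -
  define d where "d = (\<lambda>\<alpha>. c (\<lambda>v. \<alpha> v - exps m v))"
  have "{\<alpha>. d \<alpha> \<noteq> 0} \<subseteq> (\<lambda>\<alpha> v. \<alpha> v + exps m v) ` {\<alpha>. c \<alpha> \<noteq> 0}"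
    by (auto simp: d_def image_iff fun_eq_iff) (metis diff_add_cancel)
  then have "finite {\<alpha>. d \<alpha> \<noteq> 0}"
    by (rule finite_subset) (simp add: assms(1))
  moreover have "\<forall>v. 0 \<le> \<alpha> v" if "d \<alpha> \<noteq> 0" for \<alpha>
    using assms(2)[of "\<lambda>v. \<alpha> v - exps m v"] that by (simp add: d_def)
  ultimately obtain f where f: "coeff_at f = d"
    using coeff_at_exists by blast
  then have "c = (\<lambda>\<alpha>. coeff_at f (\<lambda>v. \<alpha> v + exps m v))"
    by (simp add: d_def)
  then show ?thesis
    using f laurentI[of f m] by (auto simp: d_def)
qed

text \<open>Clearing denominators needs only \<open>b = 0\<close>; for a numerator inside the ideal,
  \<open>b\<close> will be a common bound for the weights.\<close>

lemma finite_family_bounded_below: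
  fixes A :: "(4 \<Rightarrow> int) set"
  assumes "finite A"
  shows "\<exists>n. \<forall>\<alpha>\<in>A. \<forall>v. int b \<le> \<alpha> v + int n"
proof -
  define n where "n = (\<Sum>\<alpha>\<in>A. \<Sum>v\<in>UNIV. nat (int b - \<alpha> v))"
  have "int b \<le> \<alpha> v + int n" if "\<alpha> \<in> A" for \<alpha> v
  proof -
    have "nat (int b - \<alpha> v) \<le> (\<Sum>v\<in>UNIV. nat (int b - \<alpha> v))"
      by (rule member_le_sum) auto
    also have "\<dots> \<le> n"
      unfolding n_def using that assms by (intro member_le_sum) auto
    finally show ?thesis by linarith
  qed
  then show ?thesis by blast
qed

lemma prod_var_power:
  "\<exists>m. (\<Prod>v\<in>\<sigma>. var v) ^ n = Poly_Mapping.single m (1::'k::field) \<and>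
     (\<forall>v. exps m v = (if v \<in> \<sigma> then int n else 0))"
proof -
  define e :: "4 \<Rightarrow>\<^sub>0 nat" where "e = (\<Sum>v\<in>\<sigma>. Poly_Mapping.single v 1)"
  have e: "Poly_Mapping.lookup e v = (if v \<in> \<sigma> then 1 else 0)" for v
    by (simp add: e_def lookup_sum lookup_single_one)
  have "finite \<sigma>" by simp
  then have pr: "(\<Prod>v\<in>\<sigma>. var v) = Poly_Mapping.single e (1::'k)"
    unfolding e_def by (induction rule: finite_induct) (simp_all add: var_def mult_single)
  have "\<exists>m. Poly_Mapping.single e 1 ^ n = Poly_Mapping.single m (1::'k) \<and>
     (\<forall>v. exps m v = (if v \<in> \<sigma> then int n else 0))"
  proof (induction n)
    case 0
    show ?case by (rule exI[of _ 0]) (simp add: exps_def)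
  next
    case (Suc n)
    then obtain m where m: "Poly_Mapping.single e 1 ^ n = Poly_Mapping.single m (1::'k)"
      "\<forall>v. exps m v = (if v \<in> \<sigma> then int n else 0)"
      by blast
    show ?case
      using m by (intro exI[of _ "e + m"]) (auto simp: mult_single exps_def lookup_add e)
  qed
  then show ?thesis by (simp add: pr)
qed

section \<open>Multidegrees occurring in Cech sections\<close>

definition admissible :: "(nat \<Rightarrow> nat) \<Rightarrow> 4 set \<Rightarrow> (4 \<Rightarrow> int) \<Rightarrow> bool" where
  "admissible w \<sigma> \<alpha> \<longleftrightarrow> (\<forall>v. v \<notin> \<sigma> \<longrightarrow> 0 \<le> \<alpha> v) \<and>
     (\<forall>p q. p \<notin> \<sigma> \<longrightarrow> q \<notin> \<sigma> \<longrightarrow> int (edge_weight w p q) \<le> \<alpha> p + \<alpha> q)"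

text \<open>Inverting the indeterminates in \<sigma> frees their exponents, so of the conditions
  defining the ideal only those lying wholly outside \<sigma> survive.\<close>

lemma sections_iff:
  fixes z :: "'k::field ring4 fract"
  shows "z \<in> sections (tetrahedral_ideal w) j \<sigma> \<longleftrightarrow>
    (\<exists>c. laurent z c \<and> (\<forall>\<alpha>. c \<alpha> \<noteq> 0 \<longrightarrow> admissible w \<sigma> \<alpha> \<and> (\<Sum>v\<in>UNIV. \<alpha> v) = j))"
    (is "?L \<longleftrightarrow> ?R")
proof
  assume ?L
  then obtain f n where z: "z = Fract f ((\<Prod>v\<in>\<sigma>. var v) ^ n)" and f: "f \<in> tetrahedral_ideal w"
    and hom: "homogeneous (j + int n * int (card \<sigma>)) f"
    by (auto simp: sections_def)
  obtain m where m: "(\<Prod>v\<in>\<sigma>. var v) ^ n = Poly_Mapping.single m (1::'k)"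
     "\<And>v. exps m v = (if v \<in> \<sigma> then int n else 0)"
    using prod_var_power by blast
  define c where "c = (\<lambda>\<alpha>. coeff_at f (\<lambda>v. \<alpha> v + exps m v))"
  have "laurent z c"
    unfolding z c_def m(1) by (rule laurentI)
  moreover have "admissible w \<sigma> \<alpha> \<and> (\<Sum>v\<in>UNIV. \<alpha> v) = j" if nz: "c \<alpha> \<noteq> 0" for \<alpha>
  proof -
    obtain k where k: "k \<in> Poly_Mapping.keys f" "(\<lambda>v. \<alpha> v + exps m v) = exps k"
      using nz by (auto simp: c_def coeff_at_nonzero)
    have \<alpha>: "\<alpha> v = int (Poly_Mapping.lookup k v) - (if v \<in> \<sigma> then int n else 0)" for v
      using fun_cong[OF k(2), of v] m(2)[of v] by (simp add: exps_def)
    have "edge_weight w p q \<le> Poly_Mapping.lookup k p + Poly_Mapping.lookup k q" for p q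
      using f k by (auto simp: tetrahedral_ideal_iff)
    then have "admissible w \<sigma> \<alpha>"
      by (simp add: admissible_def \<alpha> flip: of_nat_add)
    moreover have "int (\<Sum>v\<in>UNIV. Poly_Mapping.lookup k v) = j + int n * int (card \<sigma>)"
      using hom k by (simp add: homogeneous_def)
    then have "(\<Sum>v\<in>UNIV. \<alpha> v) = j"
      by (simp add: \<alpha> sum_subtractf sum.If_cases)
    ultimately show ?thesis by blast
  qed
  ultimately show ?R by blast
next
  assume ?R
  then obtain c where c: "laurent z c" and adm: "\<And>\<alpha>. c \<alpha> \<noteq> 0 \<Longrightarrow> admissible w \<sigma> \<alpha>"
    and deg: "\<And>\<alpha>. c \<alpha> \<noteq> 0 \<Longrightarrow> (\<Sum>v\<in>UNIV. \<alpha> v) = j"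
    by blast
  \<comment> \<open>The power \<open>n\<close> is chosen so large that in the numerator every
    exponent at a vertex of \<sigma> is at least \<open>b\<close>, hence at least any single weight.
    Every edge meeting \<sigma> is then satisfied, and \<open>admissible\<close> takes care of the
    others.\<close>
  define b where "b = w 1 + w 2 + w 3 + w 4 + w 5 + w 6"
  have b: "edge_weight w p q \<le> b" for p q
    by (simp add: b_def edge_weight_def)
  obtain n where n: "\<And>\<alpha> v. c \<alpha> \<noteq> 0 \<Longrightarrow> int b \<le> \<alpha> v + int n"
    using finite_family_bounded_below[OF laurent_finite[OF c], of b] by auto
  obtain m where m: "(\<Prod>v\<in>\<sigma>. var v) ^ n = Poly_Mapping.single m (1::'k)"
     "\<And>v. exps m v = (if v \<in> \<sigma> then int n else 0)"
    using prod_var_power by blast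
  have shift: "0 \<le> \<alpha> v + exps m v" if "c \<alpha> \<noteq> 0" for \<alpha> v
    using n[OF that, of v] adm[OF that] by (auto simp: m(2) admissible_def)
  have "\<exists>f. laurent (Fract f (Poly_Mapping.single m 1)) c \<and>
      (\<forall>\<alpha>. coeff_at f \<alpha> = c (\<lambda>v. \<alpha> v - exps m v))"
    using laurent_finite[OF c] shift by (rule laurent_exists_denominator)
  then obtain f where f: "laurent (Fract f (Poly_Mapping.single m 1)) c"
      "\<And>\<alpha>. coeff_at f \<alpha> = c (\<lambda>v. \<alpha> v - exps m v)"
    by blast
  have z: "z = Fract f ((\<Prod>v\<in>\<sigma>. var v) ^ n)"
    using laurent_inject[OF c f(1)] m(1) by simp
  have key: "c (\<lambda>v. exps k v - exps m v) \<noteq> 0" if "k \<in> Poly_Mapping.keys f" for k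
    using that by (simp flip: f(2) add: coeff_at_exps in_keys_iff)
  have "f \<in> tetrahedral_ideal w"
    unfolding tetrahedral_ideal_iff
  proof (intro ballI allI)
    fix k p q assume k: "k \<in> Poly_Mapping.keys f"
    define \<alpha> where "\<alpha> = (\<lambda>v. exps k v - exps m v)"
    have \<alpha>: "admissible w \<sigma> \<alpha>" "\<And>v. int b \<le> \<alpha> v + int n"
      unfolding \<alpha>_def using adm[OF key[OF k]] n[OF key[OF k]] by auto
    have in_\<sigma>: "int b \<le> exps k v" if "v \<in> \<sigma>" for v
      using \<alpha>(2)[of v] that by (simp add: \<alpha>_def m(2))
    have off_\<sigma>: "exps k v = \<alpha> v" if "v \<notin> \<sigma>" for v
      using that by (simp add: \<alpha>_def m(2))
    have nonneg: "0 \<le> exps k v" for v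
      by (simp add: exps_def)
    have "int (edge_weight w p q) \<le> int b"
      using b by simp
    then have "int (edge_weight w p q) \<le> exps k p + exps k q"
      using in_\<sigma>[of p] in_\<sigma>[of q] nonneg[of p] nonneg[of q] \<alpha>(1) off_\<sigma>[of p] off_\<sigma>[of q]
      unfolding admissible_def by (cases "p \<in> \<sigma>"; cases "q \<in> \<sigma>") auto
    then show "edge_weight w p q \<le> Poly_Mapping.lookup k p + Poly_Mapping.lookup k q"
      by (simp add: exps_def)
  qed
  moreover have "homogeneous (j + int n * int (card \<sigma>)) f"
    unfolding homogeneous_def
  proof
    fix k assume k: "k \<in> Poly_Mapping.keys f"
    show "int (\<Sum>v\<in>UNIV. Poly_Mapping.lookup k v) = j + int n * int (card \<sigma>)"
      using deg[OF key[OF k]] by (simp add: m(2) sum_subtractf sum.If_cases) (simp add: exps_def mult.commute)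
  qed
  ultimately show ?L
    unfolding z sections_def by blast
qed

section \<open>Critical multidegrees and the local cocycle problem\<close>

lemma admissible_mono:
  "admissible w \<sigma> \<alpha> \<Longrightarrow> (\<And>v. \<alpha> v \<le> \<beta> v) \<Longrightarrow> admissible w \<sigma> \<beta>"
  unfolding admissible_def by (meson add_mono order_trans)

lemma all_4:
  assumes "{p, q, r, s} = (UNIV :: 4 set)"
  shows "(\<forall>v. P v) \<longleftrightarrow> P p \<and> P q \<and> P r \<and> P s"
  using assms by (metis UNIV_I empty_iff insert_iff)

lemma distinct_4:
  assumes "{p, q, r, s} = (UNIV :: 4 set)"
  shows "distinct [p, q, r, s]"
proof (rule card_distinct)
  have "set [p, q, r, s] = (UNIV :: 4 set)" using assms by simp
  then show "card (set [p, q, r, s]) = length [p, q, r, s]" by simp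
qed

lemma edge_weight_same: "edge_weight w p p = 0"
  by (auto simp: edge_weight_def)

lemma admissible_pair_iff:
  assumes "{p, q, r, s} = (UNIV :: 4 set)"
  shows "admissible w {p, q} \<alpha> \<longleftrightarrow>
    0 \<le> \<alpha> r \<and> 0 \<le> \<alpha> s \<and> int (edge_weight w r s) \<le> \<alpha> r + \<alpha> s"
  using distinct_4[OF assms] unfolding admissible_def all_4[OF assms]
  by (auto simp: edge_weight_same edge_weight_commute[of w s r] add.commute)

lemma admissible_single_iff:
  assumes "{p, q, r, s} = (UNIV :: 4 set)"
  shows "admissible w {p} \<alpha> \<longleftrightarrow> 0 \<le> \<alpha> q \<and> 0 \<le> \<alpha> r \<and> 0 \<le> \<alpha> s \<and>
    int (edge_weight w q r) \<le> \<alpha> q + \<alpha> r \<and> int (edge_weight w q s) \<le> \<alpha> q + \<alpha> s \<and>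
    int (edge_weight w r s) \<le> \<alpha> r + \<alpha> s"
  using distinct_4[OF assms] unfolding admissible_def all_4[OF assms]
  by (auto simp: edge_weight_same edge_weight_commute[of w s r] edge_weight_commute[of w s q]
      edge_weight_commute[of w r q] add.commute)

text \<open>The multidegrees in which the first cohomology is nonzero: call an edge of the tetrahedron
  violated when its inequality fails; the violated edges form a perfect matching.\<close>

definition critical :: "(nat \<Rightarrow> nat) \<Rightarrow> (4 \<Rightarrow> int) \<Rightarrow> bool" where
  "critical w \<alpha> \<longleftrightarrow> (\<forall>v. 0 \<le> \<alpha> v) \<and> (\<exists>p q r s. {p, q, r, s} = UNIV \<and>
     \<alpha> p + \<alpha> q < int (edge_weight w p q) \<and> \<alpha> r + \<alpha> s < int (edge_weight w r s) \<and>
     int (edge_weight w p r) \<le> \<alpha> p + \<alpha> r \<and> int (edge_weight w p s) \<le> \<alpha> p + \<alpha> s \<and>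
     int (edge_weight w q r) \<le> \<alpha> q + \<alpha> r \<and> int (edge_weight w q s) \<le> \<alpha> q + \<alpha> s)"

lemma criticalI:
  assumes "{p, q, r, s} = UNIV" "0 \<le> \<alpha> p" "0 \<le> \<alpha> q" "0 \<le> \<alpha> r" "0 \<le> \<alpha> s"
     "\<alpha> p + \<alpha> q < int (edge_weight w p q)" "\<alpha> r + \<alpha> s < int (edge_weight w r s)"
     "int (edge_weight w p r) \<le> \<alpha> p + \<alpha> r" "int (edge_weight w p s) \<le> \<alpha> p + \<alpha> s"
     "int (edge_weight w q r) \<le> \<alpha> q + \<alpha> r" "int (edge_weight w q s) \<le> \<alpha> q + \<alpha> s"
  shows "critical w \<alpha>"
  unfolding critical_def all_4[OF assms(1), of "\<lambda>v. 0 \<le> \<alpha> v"]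
  using assms by blast

text \<open>Of two disjoint violated edges at least one avoids u. Hence sections over a single chart
  have no term in a critical multidegree, and coboundaries have none either.\<close>

lemma critical_not_admissible:
  assumes "critical w \<alpha>"
  shows "\<not> admissible w {u} \<alpha>"
proof -
  obtain p q r s where U: "{p, q, r, s} = UNIV"
    and v: "\<alpha> p + \<alpha> q < int (edge_weight w p q)" "\<alpha> r + \<alpha> s < int (edge_weight w r s)"
    using assms by (auto simp: critical_def)
  show ?thesis
  proof (cases "u \<in> {p, q}")
    case True
    then have "r \<notin> {u}" "s \<notin> {u}" using distinct_4[OF U] by auto
    then show ?thesis using v(2) by (auto simp: admissible_def) (metis not_le)
  next
    case False
    then have "p \<notin> {u}" "q \<notin> {u}" by auto
    then show ?thesis using v(1) by (auto simp: admissible_def) (metis not_le)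
  qed
qed

lemma other_two:
  assumes "v \<noteq> u"
  shows "\<exists>r s. {v, u, r, s} = (UNIV :: 4 set)"
proof -
  have "card (UNIV - {v, u} :: 4 set) = 2"
    using assms by (simp add: card_Diff_subset)
  then obtain r s where "UNIV - {v, u} = {r, s}"
    by (auto simp: card_2_iff)
  then have "{v, u, r, s} = UNIV" by blast
  then show ?thesis by blast
qed

text \<open>Here \<open>b\<close> is the potential of a cocycle in multidegree \<alpha>, and
  \<open>adm\<close> says that it changes only across admissible pairs. Two forbidden vertices with
  different values force the forbidden pairs to be {v, r} and {u, s}, or the same with r and s
  exchanged.\<close>

lemma critical_of_distinct_values:
  assumes adm: "\<And>x y. b x \<noteq> b y \<Longrightarrow> admissible w {x, y} \<alpha>"
    and v: "\<not> admissible w {v} \<alpha>" and u: "\<not> admissible w {u} \<alpha>" and vu: "b v \<noteq> b u"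
  shows "critical w \<alpha>"
proof -
  have "v \<noteq> u" using vu by blast
  then obtain r s where U: "{v, u, r, s} = UNIV" using other_two by blast
  have perms: "{u, v, r, s} = UNIV" "{v, r, u, s} = UNIV" "{v, s, u, r} = UNIV" "{u, r, v, s} = UNIV"
      "{u, s, v, r} = UNIV" "{r, s, v, u} = UNIV"
    unfolding U[symmetric] by blast+
  note E = edge_weight_commute[of w]
  \<comment> \<open>Admissibility of a pair is a statement about the complementary one: different
    values at two vertices show that the opposite edge is satisfied and has nonnegative
    ends.\<close>
  have "admissible w {v, u} \<alpha>" using adm vu by blast
  then have rs: "0 \<le> \<alpha> r" "0 \<le> \<alpha> s" "int (edge_weight w r s) \<le> \<alpha> r + \<alpha> s"
    using admissible_pair_iff[OF U] by blast+
  have vr: "0 \<le> \<alpha> u" "int (edge_weight w u s) \<le> \<alpha> u + \<alpha> s" if "b v \<noteq> b r"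
    using adm[OF that] admissible_pair_iff[OF perms(2)] by blast+
  have vs: "0 \<le> \<alpha> u" "int (edge_weight w u r) \<le> \<alpha> u + \<alpha> r" if "b v \<noteq> b s"
    using adm[OF that] admissible_pair_iff[OF perms(3)] by blast+
  have ur: "0 \<le> \<alpha> v" "int (edge_weight w v s) \<le> \<alpha> v + \<alpha> s" if "b u \<noteq> b r"
    using adm[OF that] admissible_pair_iff[OF perms(4)] by blast+
  have us: "0 \<le> \<alpha> v" "int (edge_weight w v r) \<le> \<alpha> v + \<alpha> r" if "b u \<noteq> b s"
    using adm[OF that] admissible_pair_iff[OF perms(5)] by blast+
  have sr: "int (edge_weight w v u) \<le> \<alpha> v + \<alpha> u" if "b r \<noteq> b s"
    using adm[OF that] admissible_pair_iff[OF perms(6)] by blast+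
  have nv: "\<not> (0 \<le> \<alpha> u \<and> int (edge_weight w u r) \<le> \<alpha> u + \<alpha> r \<and> int (edge_weight w u s) \<le> \<alpha> u + \<alpha> s)"
    using v rs admissible_single_iff[OF U] by blast
  have nu: "\<not> (0 \<le> \<alpha> v \<and> int (edge_weight w v r) \<le> \<alpha> v + \<alpha> r \<and> int (edge_weight w v s) \<le> \<alpha> v + \<alpha> s)"
    using u rs admissible_single_iff[OF perms(1)] by blast
  \<comment> \<open>If the value at v differed from those at r and s, the edges us and ur would be
    satisfied along with rs, and v would be admissible. The same holds for u, and since v and u have
    different values they must be paired with different vertices.\<close>
  have "b v = b r \<or> b v = b s" using vr vs nv by blast
  moreover have "b u = b r \<or> b u = b s" using ur us nu by blast
  ultimately consider "b v = b r" "b u = b s" | "b v = b s" "b u = b r" using vu by metis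
  then show ?thesis
  proof cases
    case 1
    then have ne: "b v \<noteq> b s" "b u \<noteq> b r" "b r \<noteq> b s" using vu by auto
    show ?thesis
      by (rule criticalI[OF perms(2)])
        (use rs vs[OF ne(1)] ur[OF ne(2)] sr[OF ne(3)] nv nu E[of r u] E[of r s]  in \<open>auto simp: not_le add.commute\<close>)
  next
    case 2
    then have ne: "b v \<noteq> b r" "b u \<noteq> b s" "b r \<noteq> b s" using vu by auto
    show ?thesis
      by (rule criticalI[OF perms(3)])
        (use rs vr[OF ne(1)] us[OF ne(2)] sr[OF ne(3)] nv nu E[of s u] E[of s r] in \<open>auto simp: not_le add.commute\<close>)
  qed
qed

text \<open>By \<open>critical_of_distinct_values\<close> the potential is constant on the
  inadmissible vertices, and subtracting that constant makes it vanish there. The last conjunct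
  keeps supports finite when the choices for all multidegrees are assembled.\<close>

lemma noncritical_coboundary:
  fixes c :: "4 \<Rightarrow> 4 \<Rightarrow> 'a::ab_group_add"
  assumes cocycle: "\<And>p q r. c q r - c p r + c p q = 0"
    and supp: "\<And>p q. c p q \<noteq> 0 \<Longrightarrow> admissible w {p, q} \<alpha>"
    and "\<not> critical w \<alpha>"
  shows "\<exists>s. (\<forall>p q. c p q = s q - s p) \<and> (\<forall>p. s p \<noteq> 0 \<longrightarrow> admissible w {p} \<alpha>) \<and>
    ((\<forall>p q. c p q = 0) \<longrightarrow> (\<forall>p. s p = 0))"
proof -
  define b where "b = c 0"
  have b: "c p q = b q - b p" for p q
    using cocycle[of p q 0] by (simp add: b_def algebra_simps)
  have const: "b v = b u" if "\<not> admissible w {v} \<alpha>" "\<not> admissible w {u} \<alpha>" for v u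
    using critical_of_distinct_values[of b w \<alpha> v u] that assms(3) supp unfolding b by fastforce
  \<comment> \<open>If all vertices are admissible, \<open>v\<close> is arbitrary, which is harmless
    because nothing is then required to vanish.\<close>
  define v where "v = (SOME v. \<not> admissible w {v} \<alpha>)"
  define s where "s = (\<lambda>u. b u - b v)"
  have "c p q = s q - s p" for p q
    by (simp add: s_def b)
  moreover have "admissible w {p} \<alpha>" if "s p \<noteq> 0" for p
  proof (rule ccontr)
    assume p: "\<not> admissible w {p} \<alpha>"
    then have "\<not> admissible w {v} \<alpha>"
      unfolding v_def by (rule someI)
    then show False
      using const[OF p] that by (simp add: s_def)
  qed
  moreover have "s p = 0" if "\<forall>p q. c p q = 0" for p
    using that b[of v p] by (simp add: s_def)
  ultimately show ?thesis by blast
qed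

section \<open>Cohomology classes and the Rao module, degree by degree\<close>

lemma sections_zero: "0 \<in> sections (tetrahedral_ideal w) j \<sigma>"
  unfolding sections_iff by (intro exI[of _ "\<lambda>\<alpha>. 0"]) (simp add: laurent_zero)

lemma sections_diff:
  assumes "z \<in> sections (tetrahedral_ideal w) j \<sigma>" "y \<in> sections (tetrahedral_ideal w) j \<sigma>"
  shows "z - y \<in> sections (tetrahedral_ideal w) j \<sigma>"
proof -
  obtain c d where "laurent z c" "\<And>\<alpha>. c \<alpha> \<noteq> 0 \<Longrightarrow> admissible w \<sigma> \<alpha> \<and> (\<Sum>v\<in>UNIV. \<alpha> v) = j"
    "laurent y d" "\<And>\<alpha>. d \<alpha> \<noteq> 0 \<Longrightarrow> admissible w \<sigma> \<alpha> \<and> (\<Sum>v\<in>UNIV. \<alpha> v) = j"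
    using assms unfolding sections_iff by blast
  then show ?thesis
    unfolding sections_iff by (intro exI[of _ "\<lambda>\<alpha>. c \<alpha> - d \<alpha>"]) (metis diff_self laurent_diff)
qed

lemma sum_fun_upd_minus_one:
  "(\<Sum>u\<in>UNIV. (\<alpha>(v := \<alpha> v - 1)) u) = (\<Sum>u\<in>(UNIV :: 4 set). \<alpha> u) - (1 :: int)"
proof -
  have "(\<Sum>u\<in>UNIV. (\<alpha>(v := \<alpha> v - 1)) u) = (\<Sum>u\<in>UNIV. \<alpha> u - (if u = v then 1 else 0))"
    by (rule sum.cong) auto
  then show ?thesis by (simp add: sum_subtractf)
qed

lemma sections_var_mult:
  assumes "z \<in> sections (tetrahedral_ideal w) j \<sigma>"
  shows "Fract (var v) 1 * z \<in> sections (tetrahedral_ideal w) (j + 1) \<sigma>"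
proof -
  obtain c where c: "laurent z c" "\<And>\<alpha>. c \<alpha> \<noteq> 0 \<Longrightarrow> admissible w \<sigma> \<alpha> \<and> (\<Sum>v\<in>UNIV. \<alpha> v) = j"
    using assms unfolding sections_iff by blast
  have "admissible w \<sigma> \<alpha> \<and> (\<Sum>v\<in>UNIV. \<alpha> v) = j + 1" if "c (\<alpha>(v := \<alpha> v - 1)) \<noteq> 0" for \<alpha>
    using c(2)[OF that] sum_fun_upd_minus_one[of \<alpha> v]
      admissible_mono[of w \<sigma> "\<alpha>(v := \<alpha> v - 1)" \<alpha>] by auto
  then show ?thesis
    unfolding sections_iff using laurent_var_mult[OF c(1), of v] by blast
qed

lemma cocycles1_zero: "(\<lambda>p q. 0) \<in> cocycles1 (tetrahedral_ideal w) j"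
  by (simp add: cocycles1_def sections_zero)

lemma cocycles1_var_mult:
  fixes t :: "'a::field cochain1"
  assumes "t \<in> cocycles1 (tetrahedral_ideal w) j"
  shows "(\<lambda>p q. Fract (var v) 1 * t p q) \<in> cocycles1 (tetrahedral_ideal w) (j + 1)"
proof -
  have "x * b - x * c + x * a = x * (b - c + a)" for x a b c :: "'a ring4 fract"
    by (simp only: distrib_left right_diff_distrib)
  then show ?thesis
    using assms by (simp add: cocycles1_def sections_var_mult)
qed

lemma coboundaries1_zero: "(\<lambda>p q. 0) \<in> coboundaries1 (tetrahedral_ideal w) j"
  unfolding coboundaries1_def
  by (rule CollectI, rule exI[of _ "\<lambda>p. 0"]) (simp add: sections_zero)

lemma coboundaries1_diff:
  assumes "t \<in> coboundaries1 (tetrahedral_ideal w) j" "u \<in> coboundaries1 (tetrahedral_ideal w) j"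
  shows "(\<lambda>p q. t p q - u p q) \<in> coboundaries1 (tetrahedral_ideal w) j"
proof -
  obtain r s where "t = (\<lambda>p q. r q - r p)" "\<And>p. r p \<in> sections (tetrahedral_ideal w) j {p}"
    "u = (\<lambda>p q. s q - s p)" "\<And>p. s p \<in> sections (tetrahedral_ideal w) j {p}"
    using assms unfolding coboundaries1_def by blast
  then show ?thesis
    unfolding coboundaries1_def
    by (intro CollectI exI[of _ "\<lambda>p. r p - s p"]) (simp add: sections_diff fun_eq_iff)
qed

lemma coboundaries1_var_mult:
  assumes "t \<in> coboundaries1 (tetrahedral_ideal w) j"
  shows "(\<lambda>p q. Fract (var v) 1 * t p q) \<in> coboundaries1 (tetrahedral_ideal w) (j + 1)"
proof -
  obtain s where "t = (\<lambda>p q. s q - s p)" "\<And>p. s p \<in> sections (tetrahedral_ideal w) j {p}"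
    using assms unfolding coboundaries1_def by blast
  then show ?thesis
    unfolding coboundaries1_def
    by (intro CollectI exI[of _ "\<lambda>p. Fract (var v) 1 * s p"])
      (simp add: sections_var_mult right_diff_distrib)
qed

lemma equiv_cohomologous:
  "equiv (cocycles1 (tetrahedral_ideal w) j) (cohomologous (tetrahedral_ideal w) j)"
proof (rule equivI)
  let ?B = "coboundaries1 (tetrahedral_ideal w) j"
  have sym: "(\<lambda>p q. u p q - t p q) \<in> ?B" if "(\<lambda>p q. t p q - u p q) \<in> ?B" for t u
    using coboundaries1_diff[OF coboundaries1_zero that] by simp
  show "cohomologous (tetrahedral_ideal w) j
      \<subseteq> cocycles1 (tetrahedral_ideal w) j \<times> cocycles1 (tetrahedral_ideal w) j"
    by (auto simp: cohomologous_def)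
  show "refl_on (cocycles1 (tetrahedral_ideal w) j) (cohomologous (tetrahedral_ideal w) j)"
    by (auto simp: refl_on_def cohomologous_def coboundaries1_zero)
  show "sym (cohomologous (tetrahedral_ideal w) j)"
    using sym by (auto simp: sym_def cohomologous_def)
  show "trans (cohomologous (tetrahedral_ideal w) j)"
  proof (rule transI)
    fix t u x
    assume tu: "(t, u) \<in> cohomologous (tetrahedral_ideal w) j"
      and ux: "(u, x) \<in> cohomologous (tetrahedral_ideal w) j"
    then have "(\<lambda>p q. t p q - u p q) \<in> ?B" "(\<lambda>p q. x p q - u p q) \<in> ?B"
      using sym[of u x] by (simp_all add: cohomologous_def)
    from coboundaries1_diff[OF this] have "(\<lambda>p q. t p q - x p q) \<in> ?B"
      by simp
    then show "(t, x) \<in> cohomologous (tetrahedral_ideal w) j"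
      using tu ux by (simp add: cohomologous_def)
  qed
qed

lemma cohomology_class_eq_zero_iff:
  assumes "t \<in> cocycles1 (tetrahedral_ideal w) j"
  shows "cohomologous (tetrahedral_ideal w) j `` {t} = H1_zero (tetrahedral_ideal w) j \<longleftrightarrow>
    t \<in> coboundaries1 (tetrahedral_ideal w) j"
  unfolding H1_zero_def eq_equiv_class_iff[OF equiv_cohomologous assms cocycles1_zero]
  using assms by (simp add: cohomologous_def cocycles1_zero)

lemma H1_zero_in_H1: "H1_zero (tetrahedral_ideal w) j \<in> H1 (tetrahedral_ideal w) j"
  unfolding H1_zero_def H1_def by (rule quotientI) (rule cocycles1_zero)

text \<open>\<open>H1_mult\<close> is a union over all representatives. Multiplication by an
  indeterminate preserves coboundaries, so each representative contributes the same class.\<close>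

lemma H1_mult_class:
  assumes t: "t \<in> cocycles1 (tetrahedral_ideal w) j"
  shows "H1_mult (tetrahedral_ideal w) j v (cohomologous (tetrahedral_ideal w) j `` {t}) =
    cohomologous (tetrahedral_ideal w) (j + 1) `` {\<lambda>p q. Fract (var v) 1 * t p q}"
proof -
  have "cohomologous (tetrahedral_ideal w) (j + 1) `` {\<lambda>p q. Fract (var v) 1 * u p q} =
      cohomologous (tetrahedral_ideal w) (j + 1) `` {\<lambda>p q. Fract (var v) 1 * t p q}"
    if "u \<in> cohomologous (tetrahedral_ideal w) j `` {t}" for u
  proof (rule equiv_class_eq[OF equiv_cohomologous])
    have "(t, u) \<in> cohomologous (tetrahedral_ideal w) j"
      using that by blast
    then have ut: "(u, t) \<in> cohomologous (tetrahedral_ideal w) j"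
      using equiv_cohomologous by (metis equivE symD)
    then show "(\<lambda>p q. Fract (var v) 1 * u p q, \<lambda>p q. Fract (var v) 1 * t p q)
        \<in> cohomologous (tetrahedral_ideal w) (j + 1)"
      using coboundaries1_var_mult[of "\<lambda>p q. u p q - t p q" w j v]
      by (simp add: cohomologous_def cocycles1_var_mult right_diff_distrib)
  qed
  then have "H1_mult (tetrahedral_ideal w) j v (cohomologous (tetrahedral_ideal w) j `` {t}) =
      (\<Union>u\<in>cohomologous (tetrahedral_ideal w) j `` {t}.
        cohomologous (tetrahedral_ideal w) (j + 1) `` {\<lambda>p q. Fract (var v) 1 * t p q})"
    unfolding H1_mult_def by (intro SUP_cong refl)
  also have "\<dots> = cohomologous (tetrahedral_ideal w) (j + 1) `` {\<lambda>p q. Fract (var v) 1 * t p q}"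
    using equiv_class_self[OF equiv_cohomologous t] by blast
  finally show ?thesis .
qed

text \<open>A single class extended by zero lets both properties of the module be tested in one
  degree at a time.\<close>

lemma concentrated_in_rao_module:
  assumes "t \<in> cocycles1 (tetrahedral_ideal w) j"
  shows "(rao_zero (tetrahedral_ideal w))(j := cohomologous (tetrahedral_ideal w) j `` {t})
    \<in> rao_module (tetrahedral_ideal w)"
proof -
  have "{i. ((rao_zero (tetrahedral_ideal w))(j := cohomologous (tetrahedral_ideal w) j `` {t})) i
      \<noteq> H1_zero (tetrahedral_ideal w) i} \<subseteq> {j}"
    by (auto simp: rao_zero_def)
  then show ?thesis
    unfolding rao_module_def
    using assms H1_zero_in_H1 by (auto simp: H1_def rao_zero_def intro: quotientI finite_subset)
qed

lemma arithmetically_CM_iff: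
  "arithmetically_CM (tetrahedral_ideal w :: 'k::field ring4 set) \<longleftrightarrow>
    (\<forall>j. cocycles1 (tetrahedral_ideal w :: 'k ring4 set) j \<subseteq> coboundaries1 (tetrahedral_ideal w) j)"
    (is "?L \<longleftrightarrow> ?R")
proof
  assume ?L
  have "t \<in> coboundaries1 (tetrahedral_ideal w) j"
    if t: "t \<in> cocycles1 (tetrahedral_ideal w :: 'k ring4 set) j" for t j
  proof -
    have "(rao_zero (tetrahedral_ideal w))(j := cohomologous (tetrahedral_ideal w) j `` {t})
        = rao_zero (tetrahedral_ideal w)"
      using \<open>?L\<close> concentrated_in_rao_module[OF t] unfolding arithmetically_CM_def by blast
    then have "cohomologous (tetrahedral_ideal w) j `` {t} = H1_zero (tetrahedral_ideal w) j"
      by (metis fun_upd_same rao_zero_def)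
    then show ?thesis
      using cohomology_class_eq_zero_iff[OF t] by blast
  qed
  then show ?R by blast
next
  assume ?R
  have "m = rao_zero (tetrahedral_ideal w)"
    if "m \<in> rao_module (tetrahedral_ideal w :: 'k ring4 set)" for m
    unfolding rao_zero_def
  proof
    fix j
    have "m j \<in> H1 (tetrahedral_ideal w) j"
      using that by (simp add: rao_module_def)
    then obtain t where "m j = cohomologous (tetrahedral_ideal w) j `` {t}"
        "t \<in> cocycles1 (tetrahedral_ideal w) j"
      unfolding H1_def by (rule quotientE)
    then show "m j = H1_zero (tetrahedral_ideal w) j"
      using \<open>?R\<close> cohomology_class_eq_zero_iff by blast
  qed
  moreover have "rao_zero (tetrahedral_ideal w) \<in> rao_module (tetrahedral_ideal w :: 'k ring4 set)"
    by (simp add: rao_module_def rao_zero_def H1_zero_in_H1)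
  ultimately show ?L
    unfolding arithmetically_CM_def by blast
qed

lemma arithmetically_Buchsbaum_iff:
  "arithmetically_Buchsbaum (tetrahedral_ideal w :: 'k::field ring4 set) \<longleftrightarrow>
    (\<forall>v j. \<forall>t\<in>cocycles1 (tetrahedral_ideal w :: 'k ring4 set) j.
      (\<lambda>p q. Fract (var v) 1 * t p q) \<in> coboundaries1 (tetrahedral_ideal w) (j + 1))"
    (is "?L \<longleftrightarrow> ?R")
proof
  assume ?L
  have "(\<lambda>p q. Fract (var v) 1 * t p q) \<in> coboundaries1 (tetrahedral_ideal w) (j + 1)"
    if t: "t \<in> cocycles1 (tetrahedral_ideal w :: 'k ring4 set) j" for t j v
  proof -
    have "rao_mult (tetrahedral_ideal w) v
        ((rao_zero (tetrahedral_ideal w))(j := cohomologous (tetrahedral_ideal w) j `` {t}))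
        = rao_zero (tetrahedral_ideal w)"
      using \<open>?L\<close> concentrated_in_rao_module[OF t] unfolding arithmetically_Buchsbaum_def by blast
    from fun_cong[OF this, of "j + 1"] have "cohomologous (tetrahedral_ideal w) (j + 1) `` {\<lambda>p q. Fract (var v) 1 * t p q}
        = H1_zero (tetrahedral_ideal w) (j + 1)"
      by (simp add: rao_mult_def rao_zero_def H1_mult_class[OF t])
    then show ?thesis
      using cohomology_class_eq_zero_iff[OF cocycles1_var_mult[OF t]] by blast
  qed
  then show ?R by blast
next
  assume ?R
  have "H1_mult (tetrahedral_ideal w) j v (m j) = H1_zero (tetrahedral_ideal w) (j + 1)"
    if "m \<in> rao_module (tetrahedral_ideal w :: 'k ring4 set)" for m j v
  proof -
    have "m j \<in> H1 (tetrahedral_ideal w) j"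
      using that by (simp add: rao_module_def)
    then obtain t where "m j = cohomologous (tetrahedral_ideal w) j `` {t}"
        "t \<in> cocycles1 (tetrahedral_ideal w) j"
      unfolding H1_def by (rule quotientE)
    then show ?thesis
      using \<open>?R\<close> by (simp add: H1_mult_class cohomology_class_eq_zero_iff cocycles1_var_mult)
  qed
  from this[of _ "i - 1" for i] show ?L
    unfolding arithmetically_Buchsbaum_def by (simp add: rao_mult_def rao_zero_def fun_eq_iff)
qed

section \<open>Cohomology in terms of critical multidegrees\<close>

lemma laurent_exists:
  fixes c :: "(4 \<Rightarrow> int) \<Rightarrow> 'k::field"
  assumes "finite {\<alpha>. c \<alpha> \<noteq> 0}"
  shows "\<exists>z. laurent z c"
proof -
  obtain n where n: "\<forall>\<alpha>\<in>{\<alpha>. c \<alpha> \<noteq> 0}. \<forall>v. int 0 \<le> \<alpha> v + int n"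
    using finite_family_bounded_below[OF assms] by blast
  obtain m where "\<forall>v. exps m v = (if v \<in> UNIV then int n else 0)"
    using prod_var_power by blast
  then have "\<exists>f. laurent (Fract f (Poly_Mapping.single m 1)) c \<and>
      (\<forall>\<alpha>. coeff_at f \<alpha> = c (\<lambda>v. \<alpha> v - exps m v))"
    using n by (intro laurent_exists_denominator[OF assms]) simp
  then show ?thesis by blast
qed

lemma cocycle_coefficients:
  assumes "t \<in> cocycles1 (tetrahedral_ideal w) j"
  shows "\<exists>c. (\<forall>p q. laurent (t p q) (c p q)) \<and>
    (\<forall>p q \<alpha>. c p q \<alpha> \<noteq> 0 \<longrightarrow> admissible w {p, q} \<alpha> \<and> (\<Sum>v\<in>UNIV. \<alpha> v) = j) \<and>
    (\<forall>p q r \<alpha>. c q r \<alpha> - c p r \<alpha> + c p q \<alpha> = 0)"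
proof -
  have "\<forall>p q. \<exists>c. laurent (t p q) c \<and>
      (\<forall>\<alpha>. c \<alpha> \<noteq> 0 \<longrightarrow> admissible w {p, q} \<alpha> \<and> (\<Sum>v\<in>UNIV. \<alpha> v) = j)"
    using assms unfolding cocycles1_def sections_iff by blast
  then obtain c where c: "\<And>p q. laurent (t p q) (c p q)"
      "\<And>p q \<alpha>. c p q \<alpha> \<noteq> 0 \<Longrightarrow> admissible w {p, q} \<alpha> \<and> (\<Sum>v\<in>UNIV. \<alpha> v) = j"
    by metis
  have "c q r \<alpha> - c p r \<alpha> + c p q \<alpha> = 0" for p q r \<alpha>
  proof -
    have "t q r - t p r + t p q = 0"
      using assms by (simp add: cocycles1_def)
    then have "t q r - t p r = 0 - t p q"
      by (simp add: eq_neg_iff_add_eq_0)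
    then have "(\<lambda>\<alpha>. c q r \<alpha> - c p r \<alpha>) = (\<lambda>\<alpha>. 0 - c p q \<alpha>)"
      using laurent_inject[OF laurent_diff[OF c(1) c(1)] laurent_diff[OF laurent_zero c(1)]] by blast
    then show ?thesis
      by (metis diff_0 eq_neg_iff_add_eq_0)
  qed
  then show ?thesis using c by blast
qed

text \<open>The cocycle is solved in each multidegree separately, and the solutions are collected
  into Laurent polynomials. The third conjunct of \<open>local\<close> confines their supports to
  the finite supports of the \<open>c p q\<close>, and thereby to degree \<open>j\<close>.\<close>

lemma coboundary_of_coefficients:
  fixes c :: "4 \<Rightarrow> 4 \<Rightarrow> (4 \<Rightarrow> int) \<Rightarrow> 'k::field"
  assumes t: "\<And>p q. laurent (t p q) (c p q)"
    and deg: "\<And>p q \<alpha>. c p q \<alpha> \<noteq> 0 \<Longrightarrow> (\<Sum>v\<in>UNIV. \<alpha> v) = j"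
    and local: "\<And>\<alpha>. \<exists>s. (\<forall>p q. c p q \<alpha> = s q - s p) \<and> (\<forall>p. s p \<noteq> 0 \<longrightarrow> admissible w {p} \<alpha>) \<and>
      ((\<forall>p q. c p q \<alpha> = 0) \<longrightarrow> (\<forall>p. s p = 0))"
  shows "t \<in> coboundaries1 (tetrahedral_ideal w) j"
proof -
  obtain s where s: "\<And>\<alpha> p q. c p q \<alpha> = s \<alpha> q - s \<alpha> p"
      "\<And>\<alpha> p. s \<alpha> p \<noteq> 0 \<Longrightarrow> admissible w {p} \<alpha>"
      "\<And>\<alpha> p. (\<forall>p q. c p q \<alpha> = 0) \<Longrightarrow> s \<alpha> p = 0"
    using local by metis
  have "finite {\<alpha>. s \<alpha> p \<noteq> 0}" for p
  proof (rule finite_subset)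
    show "{\<alpha>. s \<alpha> p \<noteq> 0} \<subseteq> (\<Union>p\<in>UNIV. \<Union>q\<in>UNIV. {\<alpha>. c p q \<alpha> \<noteq> 0})"
    proof
      fix \<alpha> assume "\<alpha> \<in> {\<alpha>. s \<alpha> p \<noteq> 0}"
      then have "\<not> (\<forall>p q. c p q \<alpha> = 0)"
        using s(3)[of \<alpha> p] by blast
      then show "\<alpha> \<in> (\<Union>p\<in>UNIV. \<Union>q\<in>UNIV. {\<alpha>. c p q \<alpha> \<noteq> 0})"
        by simp
    qed
    show "finite (\<Union>p\<in>UNIV. \<Union>q\<in>UNIV. {\<alpha>. c p q \<alpha> \<noteq> 0})"
      by (intro finite_UN_I finite laurent_finite[OF t])
  qed
  then have "\<forall>p. \<exists>z. laurent z (\<lambda>\<alpha>. s \<alpha> p)"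
    by (intro allI laurent_exists)
  then obtain z where z: "\<And>p. laurent (z p) (\<lambda>\<alpha>. s \<alpha> p)"
    by metis
  have "(\<Sum>v\<in>UNIV. \<alpha> v) = j" if "s \<alpha> p \<noteq> 0" for \<alpha> p
    using s(3)[of \<alpha> p] that deg by blast
  then have "z p \<in> sections (tetrahedral_ideal w) j {p}" for p
    unfolding sections_iff using z s(2) by blast
  moreover have "t p q = z q - z p" for p q
    using laurent_inject[OF t laurent_diff[OF z z]] s(1) by (metis (no_types, lifting) ext)
  ultimately show ?thesis
    unfolding coboundaries1_def by blast
qed

lemma coboundary_critical_coefficient:
  assumes t: "laurent (t p q) c" "t \<in> coboundaries1 (tetrahedral_ideal w) j"
    and "critical w \<alpha>"
  shows "c \<alpha> = 0"
proof -
  obtain s where s: "t p q = s q - s p" "\<And>p. s p \<in> sections (tetrahedral_ideal w) j {p}"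
    using t(2) unfolding coboundaries1_def by blast
  obtain d where d: "\<And>p. laurent (s p) (d p)" "\<And>p \<alpha>. d p \<alpha> \<noteq> 0 \<Longrightarrow> admissible w {p} \<alpha>"
    using s(2) unfolding sections_iff by metis
  have "c = (\<lambda>\<alpha>. d q \<alpha> - d p \<alpha>)"
    using laurent_inject[OF t(1) laurent_diff[OF d(1) d(1)]] s(1) by blast
  moreover have "d u \<alpha> = 0" for u
    using d(2) critical_not_admissible[OF assms(3)] by blast
  ultimately show ?thesis by simp
qed

text \<open>The potential is the indicator of {r, s}, placed in multidegree \<alpha>. It jumps only
  across the four pairs joining the two violated edges; the complement of such a pair is another
  such pair, which is satisfied. The vertex functions \<open>z\<close> need not be sections, only
  their differences are.\<close>

lemma critical_cocycle:
  assumes "critical w \<alpha>"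
  shows "\<exists>(t :: 'k::field cochain1) p q c. t \<in> cocycles1 (tetrahedral_ideal w) (\<Sum>v\<in>UNIV. \<alpha> v) \<and>
    laurent (t p q) c \<and> c \<alpha> \<noteq> 0"
proof -
  obtain p q r s where U: "{p, q, r, s} = UNIV" and nonneg: "\<And>v. 0 \<le> \<alpha> v"
    and cross: "int (edge_weight w p r) \<le> \<alpha> p + \<alpha> r" "int (edge_weight w p s) \<le> \<alpha> p + \<alpha> s"
      "int (edge_weight w q r) \<le> \<alpha> q + \<alpha> r" "int (edge_weight w q s) \<le> \<alpha> q + \<alpha> s"
    using assms unfolding critical_def by blast
  define \<chi> :: "4 \<Rightarrow> 'k" where "\<chi> u = (if u \<in> {p, q} then 0 else 1)" for u
  define d where "d u \<beta> = (if \<beta> = \<alpha> then \<chi> u else 0)" for u \<beta>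
  have "finite {\<beta>. d u \<beta> \<noteq> 0}" for u
    by (rule finite_subset[of _ "{\<alpha>}"]) (auto simp: d_def)
  then have "\<forall>u. \<exists>z. laurent z (d u)"
    by (intro allI laurent_exists)
  then obtain z where z: "\<And>u. laurent (z u) (d u)"
    by metis
  define t where "t = (\<lambda>u v. z v - z u)"
  have t: "laurent (t u v) (\<lambda>\<beta>. d v \<beta> - d u \<beta>)" for u v
    unfolding t_def using z by (intro laurent_diff)
  have adm: "admissible w {u, v} \<alpha>" if "\<chi> v \<noteq> \<chi> u" for u v
  proof -
    have perms: "{p, r, q, s} = UNIV" "{p, s, q, r} = UNIV" "{q, r, p, s} = UNIV" "{q, s, p, r} = UNIV"
      unfolding U[symmetric] by blast+
    have "admissible w {p, r} \<alpha>" "admissible w {p, s} \<alpha>" "admissible w {q, r} \<alpha>" "admissible w {q, s} \<alpha>"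
      unfolding perms[THEN admissible_pair_iff] using nonneg cross by blast+
    moreover have "u \<in> {p, q, r, s}" "v \<in> {p, q, r, s}"
      using U by auto
    ultimately show ?thesis
      using that distinct_4[OF U] unfolding \<chi>_def by (auto simp: insert_commute)
  qed
  have "t u v \<in> sections (tetrahedral_ideal w) (\<Sum>v\<in>UNIV. \<alpha> v) {u, v}" for u v
    unfolding sections_iff using t[of u v] adm[of v u]
    by (intro exI[of _ "\<lambda>\<beta>. d v \<beta> - d u \<beta>"]) (auto simp: d_def)
  then have "t \<in> cocycles1 (tetrahedral_ideal w) (\<Sum>v\<in>UNIV. \<alpha> v)"
    by (simp add: cocycles1_def t_def)
  moreover have "d r \<alpha> - d p \<alpha> \<noteq> 0"
    using distinct_4[OF U] by (auto simp: d_def \<chi>_def)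
  ultimately show ?thesis using t by blast
qed

lemma arithmetically_CM_iff_no_critical:
  "arithmetically_CM (tetrahedral_ideal w :: 'k::field ring4 set) \<longleftrightarrow> \<not> (\<exists>\<alpha>. critical w \<alpha>)"
  unfolding arithmetically_CM_iff
proof
  assume all: "\<forall>j. cocycles1 (tetrahedral_ideal w :: 'k ring4 set) j \<subseteq> coboundaries1 (tetrahedral_ideal w) j"
  have False if cr: "critical w \<alpha>" for \<alpha>
  proof -
    obtain t :: "'k cochain1" and p q c where "t \<in> cocycles1 (tetrahedral_ideal w) (\<Sum>v\<in>UNIV. \<alpha> v)"
      "laurent (t p q) c" "c \<alpha> \<noteq> 0"
      using critical_cocycle[OF cr] by blast
    then show False
      using all coboundary_critical_coefficient[OF _ _ cr] by blast
  qed
  then show "\<not> (\<exists>\<alpha>. critical w \<alpha>)" by blast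
next
  assume none: "\<not> (\<exists>\<alpha>. critical w \<alpha>)"
  have "t \<in> coboundaries1 (tetrahedral_ideal w) j"
    if t: "t \<in> cocycles1 (tetrahedral_ideal w :: 'k ring4 set) j" for t j
  proof -
    obtain c where c: "\<And>p q. laurent (t p q) (c p q)"
      "\<And>p q \<alpha>. c p q \<alpha> \<noteq> 0 \<Longrightarrow> admissible w {p, q} \<alpha> \<and> (\<Sum>v\<in>UNIV. \<alpha> v) = j"
      "\<And>p q r \<alpha>. c q r \<alpha> - c p r \<alpha> + c p q \<alpha> = 0"
      using cocycle_coefficients[OF t] by blast
    show ?thesis
    proof (rule coboundary_of_coefficients[OF c(1)])
      show "(\<Sum>v\<in>UNIV. \<alpha> v) = j" if "c p q \<alpha> \<noteq> 0" for p q \<alpha>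
        using c(2)[OF that] ..
      show "\<exists>s. (\<forall>p q. c p q \<alpha> = s q - s p) \<and> (\<forall>p. s p \<noteq> 0 \<longrightarrow> admissible w {p} \<alpha>) \<and>
          ((\<forall>p q. c p q \<alpha> = 0) \<longrightarrow> (\<forall>p. s p = 0))" for \<alpha>
        by (rule noncritical_coboundary) (use c(2,3) none in auto)
    qed
  qed
  then show "\<forall>j. cocycles1 (tetrahedral_ideal w :: 'k ring4 set) j \<subseteq> coboundaries1 (tetrahedral_ideal w) j"
    by blast
qed

lemma arithmetically_Buchsbaum_iff_isolated:
  "arithmetically_Buchsbaum (tetrahedral_ideal w :: 'k::field ring4 set) \<longleftrightarrow>
    (\<forall>\<alpha> v. critical w \<alpha> \<longrightarrow> \<not> critical w (\<alpha>(v := \<alpha> v + 1)))"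
  unfolding arithmetically_Buchsbaum_iff
proof
  assume all: "\<forall>v j. \<forall>t\<in>cocycles1 (tetrahedral_ideal w :: 'k ring4 set) j.
      (\<lambda>p q. Fract (var v) 1 * t p q) \<in> coboundaries1 (tetrahedral_ideal w) (j + 1)"
  have False if cr: "critical w \<alpha>" "critical w (\<alpha>(v := \<alpha> v + 1))" for \<alpha> v
  proof -
    obtain t :: "'k cochain1" and p q c where t: "t \<in> cocycles1 (tetrahedral_ideal w) (\<Sum>v\<in>UNIV. \<alpha> v)"
      "laurent (t p q) c" "c \<alpha> \<noteq> 0"
      using critical_cocycle[OF cr(1)] by blast
    then have "(\<lambda>p q. Fract (var v) 1 * t p q) \<in> coboundaries1 (tetrahedral_ideal w) ((\<Sum>v\<in>UNIV. \<alpha> v) + 1)"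
      using all by blast
    \<comment> \<open>Multiplication moves the nonzero coefficient at \<alpha> to the next
      multidegree, which is critical as well and so excludes a coboundary.\<close>
    from coboundary_critical_coefficient[OF laurent_var_mult[OF t(2)] this cr(2)]
    show False
      using t(3) by simp
  qed
  then show "\<forall>\<alpha> v. critical w \<alpha> \<longrightarrow> \<not> critical w (\<alpha>(v := \<alpha> v + 1))" by blast
next
  assume isolated: "\<forall>\<alpha> v. critical w \<alpha> \<longrightarrow> \<not> critical w (\<alpha>(v := \<alpha> v + 1))"
  have "(\<lambda>p q. Fract (var v) 1 * t p q) \<in> coboundaries1 (tetrahedral_ideal w) (j + 1)"
    if t: "t \<in> cocycles1 (tetrahedral_ideal w :: 'k ring4 set) j" for t j v
  proof -
    obtain c where c: "\<And>p q. laurent (t p q) (c p q)"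
      "\<And>p q \<alpha>. c p q \<alpha> \<noteq> 0 \<Longrightarrow> admissible w {p, q} \<alpha> \<and> (\<Sum>v\<in>UNIV. \<alpha> v) = j"
      "\<And>p q r \<alpha>. c q r \<alpha> - c p r \<alpha> + c p q \<alpha> = 0"
      using cocycle_coefficients[OF t] by blast
    show ?thesis
    proof (rule coboundary_of_coefficients[OF laurent_var_mult[OF c(1)]])
      show "(\<Sum>v\<in>UNIV. \<alpha> v) = j + 1" if "c p q (\<alpha>(v := \<alpha> v - 1)) \<noteq> 0" for p q \<alpha>
        using c(2)[OF that] sum_fun_upd_minus_one[of \<alpha> v] by simp
      fix \<alpha> :: "4 \<Rightarrow> int"
      let ?\<beta> = "\<alpha>(v := \<alpha> v - 1)"
      have mono: "admissible w \<sigma> \<alpha>" if "admissible w \<sigma> ?\<beta>" for \<sigma>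
        using that by (rule admissible_mono) simp
      show "\<exists>s. (\<forall>p q. c p q ?\<beta> = s q - s p) \<and> (\<forall>p. s p \<noteq> 0 \<longrightarrow> admissible w {p} \<alpha>) \<and>
          ((\<forall>p q. c p q ?\<beta> = 0) \<longrightarrow> (\<forall>p. s p = 0))"
      \<comment> \<open>The product has at \<alpha> the coefficients of \<open>t\<close> at
        \<open>?\<beta>\<close>, one step below. If \<alpha> is not critical, they are solved at
        \<alpha>. If it is, isolation makes \<open>?\<beta>\<close> noncritical, and what is
        admissible at \<open>?\<beta>\<close> remains so at \<alpha>.\<close>
      proof (cases "critical w \<alpha>")
        case False
        then show ?thesis
          by (intro noncritical_coboundary) (use c(2,3) mono in auto)
      next
        case True
        have "\<alpha> = ?\<beta>(v := ?\<beta> v + 1)" by simp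
        then have "\<not> critical w ?\<beta>"
          using isolated True by metis
        then have "\<exists>s. (\<forall>p q. c p q ?\<beta> = s q - s p) \<and> (\<forall>p. s p \<noteq> 0 \<longrightarrow> admissible w {p} ?\<beta>) \<and>
            ((\<forall>p q. c p q ?\<beta> = 0) \<longrightarrow> (\<forall>p. s p = 0))"
          by (intro noncritical_coboundary) (use c(2,3) in auto)
        then show ?thesis using mono by blast
      qed
    qed
  qed
  then show "\<forall>v j. \<forall>t\<in>cocycles1 (tetrahedral_ideal w :: 'k ring4 set) j.
      (\<lambda>p q. Fract (var v) 1 * t p q) \<in> coboundaries1 (tetrahedral_ideal w) (j + 1)"
    by blast
qed

section \<open>From an isolated critical multidegree to the weights\<close>

definition matching_violated :: "(nat \<Rightarrow> nat) \<Rightarrow> (4 \<Rightarrow> int) \<Rightarrow> 4 \<Rightarrow> 4 \<Rightarrow> 4 \<Rightarrow> 4 \<Rightarrow> bool" where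
  "matching_violated w \<alpha> p q r s \<longleftrightarrow>
     \<alpha> p + \<alpha> q < int (edge_weight w p q) \<and> \<alpha> r + \<alpha> s < int (edge_weight w r s) \<and>
     int (edge_weight w p r) \<le> \<alpha> p + \<alpha> r \<and> int (edge_weight w p s) \<le> \<alpha> p + \<alpha> s \<and>
     int (edge_weight w q r) \<le> \<alpha> q + \<alpha> r \<and> int (edge_weight w q s) \<le> \<alpha> q + \<alpha> s"

lemma matching_violated_symmetries:
  "matching_violated w \<alpha> p q r s \<Longrightarrow> matching_violated w \<alpha> q p r s"
  "matching_violated w \<alpha> p q r s \<Longrightarrow> matching_violated w \<alpha> p q s r"
  "matching_violated w \<alpha> p q r s \<Longrightarrow> matching_violated w \<alpha> r s p q"
  unfolding matching_violated_def
  using edge_weight_commute[of w p q] edge_weight_commute[of w r s] edge_weight_commute[of w p r]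
    edge_weight_commute[of w p s] edge_weight_commute[of w q r] edge_weight_commute[of w q s]
  by (simp_all add: add.commute)

text \<open>The 24 labellings allowed by \<open>critical\<close> describe only three perfect
  matchings: the symmetries bring vertex 0 to the front, and exchanging the last two vertices sorts
  the rest.\<close>

lemma critical_iff_matching:
  "critical w \<alpha> \<longleftrightarrow> (\<forall>v. 0 \<le> \<alpha> v) \<and>
    (matching_violated w \<alpha> 0 1 2 3 \<or> matching_violated w \<alpha> 0 2 1 3 \<or> matching_violated w \<alpha> 0 3 1 2)"
    (is "_ \<longleftrightarrow> _ \<and> ?M")
proof -
  have "?M" if U: "{p, q, r, s} = UNIV" and m: "matching_violated w \<alpha> p q r s" for p q r s
  proof -
    have zero_first: ?M if U: "{0, q, r, s} = UNIV" and m: "matching_violated w \<alpha> 0 q r s" for q r s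
    proof -
      have "q \<in> {0, 1, 2, 3}" "r \<in> {0, 1, 2, 3}" "s \<in> {0, 1, 2, 3}"
        unfolding UNIV_4[symmetric] by auto
      then show ?thesis
        using distinct_4[OF U] m matching_violated_symmetries(2)[OF m]
        by (elim insertE emptyE) simp_all
    qed
    have perms: "{q, p, r, s} = UNIV" "{r, s, p, q} = UNIV" "{s, r, p, q} = UNIV"
      unfolding U[symmetric] by blast+
    have "0 \<in> {p, q, r, s}" using U by auto
    then consider "p = 0" | "q = 0" | "r = 0" | "s = 0" by blast
    then show ?thesis
    proof cases
      case 1
      then show ?thesis using zero_first U m by blast
    next
      case 2
      then show ?thesis
        using zero_first perms(1) matching_violated_symmetries(1)[OF m] by blast
    next
      case 3
      then show ?thesis
        using zero_first perms(2) matching_violated_symmetries(3)[OF m] by blast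
    next
      case 4
      then show ?thesis
        using zero_first perms(3) matching_violated_symmetries(1)[OF matching_violated_symmetries(3)[OF m]]
        by blast
    qed
  qed
  then have "critical w \<alpha> \<Longrightarrow> (\<forall>v. 0 \<le> \<alpha> v) \<and> ?M"
    unfolding critical_def matching_violated_def[symmetric] by blast
  moreover have "{0, 1, 2, 3} = (UNIV :: 4 set)" "{0, 2, 1, 3} = (UNIV :: 4 set)" "{0, 3, 1, 2} = (UNIV :: 4 set)"
    unfolding UNIV_4 by blast+
  then have "critical w \<alpha>" if "\<forall>v. 0 \<le> \<alpha> v" "?M"
    using that unfolding critical_def matching_violated_def[symmetric] by metis
  ultimately show ?thesis by blast
qed

lemma critical_iff:
  "critical w \<alpha> \<longleftrightarrow> 0 \<le> \<alpha> 0 \<and> 0 \<le> \<alpha> 1 \<and> 0 \<le> \<alpha> 2 \<and> 0 \<le> \<alpha> 3 \<and>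
    (\<alpha> 0 + \<alpha> 1 < int (w 1) \<and> \<alpha> 2 + \<alpha> 3 < int (w 6) \<and> int (w 2) \<le> \<alpha> 0 + \<alpha> 2 \<and>
       int (w 3) \<le> \<alpha> 0 + \<alpha> 3 \<and> int (w 4) \<le> \<alpha> 1 + \<alpha> 2 \<and> int (w 5) \<le> \<alpha> 1 + \<alpha> 3 \<or>
     \<alpha> 0 + \<alpha> 2 < int (w 2) \<and> \<alpha> 1 + \<alpha> 3 < int (w 5) \<and> int (w 1) \<le> \<alpha> 0 + \<alpha> 1 \<and>
       int (w 3) \<le> \<alpha> 0 + \<alpha> 3 \<and> int (w 4) \<le> \<alpha> 1 + \<alpha> 2 \<and> int (w 6) \<le> \<alpha> 2 + \<alpha> 3 \<or>
     \<alpha> 0 + \<alpha> 3 < int (w 3) \<and> \<alpha> 1 + \<alpha> 2 < int (w 4) \<and> int (w 1) \<le> \<alpha> 0 + \<alpha> 1 \<and>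
       int (w 2) \<le> \<alpha> 0 + \<alpha> 2 \<and> int (w 5) \<le> \<alpha> 1 + \<alpha> 3 \<and> int (w 6) \<le> \<alpha> 2 + \<alpha> 3)"
  unfolding critical_iff_matching all_4[OF UNIV_4[symmetric]] matching_violated_def edge_weight_simps
  by (auto simp: add.commute)

text \<open>\<open>A\<close> to \<open>D\<close> stand for the coordinates of the multidegree and
  \<open>ab\<close> to \<open>cd\<close> for the edge weights, with \<open>ab\<close> and
  \<open>cd\<close> on the violated edges. One alternative from each disjunction in
  \<open>tight\<close> and one failing inequality from each system in \<open>minimal\<close> leave a
  system of linear integer inequalities. The claim is thus a finite case split, in which each choice
  is contradictory or gives one of the two shapes; exchanging \<open>C\<close> and \<open>D\<close>
  exchanges the shapes.\<close>

lemma isolated_matching_shape: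
  fixes A B C D ab ac ad bc bd cd :: int
  assumes "0 \<le> A" "0 \<le> B" "0 \<le> C" "0 \<le> D"
    "0 \<le> ab" "0 \<le> ac" "0 \<le> ad" "0 \<le> bc" "0 \<le> bd" "0 \<le> cd"
    and violated: "A + B + 1 = ab" "C + D + 1 = cd"
    and cross: "ac \<le> A + C" "ad \<le> A + D" "bc \<le> B + C" "bd \<le> B + D"
    and tight: "A = 0 \<or> A + C = ac \<or> A + D = ad" "B = 0 \<or> B + C = bc \<or> B + D = bd"
      "C = 0 \<or> A + C = ac \<or> B + C = bc" "D = 0 \<or> A + D = ad \<or> B + D = bd"
    and minimal: "\<not> (bc \<le> ab + ac \<and> bd \<le> ab + ad \<and> cd \<le> ac + ad)"
      "\<not> (ac \<le> ab + bc \<and> ad \<le> ab + bd \<and> cd \<le> bc + bd)"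
      "\<not> (ab \<le> ac + bc \<and> ad \<le> ac + cd \<and> bd \<le> bc + cd)"
      "\<not> (ab \<le> ad + bd \<and> ac \<le> ad + cd \<and> bc \<le> bd + cd)"
  shows "ab = cd \<and> (ac = bd \<and> ac + 1 = ab \<and> ad = 0 \<and> bc = 0 \<or> ad = bc \<and> ad + 1 = ab \<and> ac = 0 \<and> bd = 0)"
  using assms by (smt (verit))

text \<open>The indices i and 7 - i belong to opposite edges. So among the three perfect matchings
  of the tetrahedron one carries the weight n + 1 on both edges, one carries n and one carries
  0.\<close>

definition buchsbaum_shape :: "(nat \<Rightarrow> nat) \<Rightarrow> bool" where
  "buchsbaum_shape w \<longleftrightarrow> (\<exists>i\<in>{1, 2, 3}. \<exists>j\<in>{1, 2, 3}. i \<noteq> j \<and>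
     w i + 1 = w j \<and> w j = w (7 - j) \<and> w (7 - j) = w (7 - i) + 1 \<and>
     (\<forall>l \<in> {1..6} - {i, j, 7 - i, 7 - j}. w l = 0))"

lemma weight_indices: "{1..6} = {1, 2, 3, 4, 5, 6 :: nat}"
  by auto

lemma buchsbaum_shape_iff:
  "buchsbaum_shape w \<longleftrightarrow>
    w 2 + 1 = w 1 \<and> w 1 = w 6 \<and> w 6 = w 5 + 1 \<and> w 3 = 0 \<and> w 4 = 0 \<or>
    w 3 + 1 = w 1 \<and> w 1 = w 6 \<and> w 6 = w 4 + 1 \<and> w 2 = 0 \<and> w 5 = 0 \<or>
    w 1 + 1 = w 2 \<and> w 2 = w 5 \<and> w 5 = w 6 + 1 \<and> w 3 = 0 \<and> w 4 = 0 \<or>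
    w 3 + 1 = w 2 \<and> w 2 = w 5 \<and> w 5 = w 4 + 1 \<and> w 1 = 0 \<and> w 6 = 0 \<or>
    w 1 + 1 = w 3 \<and> w 3 = w 4 \<and> w 4 = w 6 + 1 \<and> w 2 = 0 \<and> w 5 = 0 \<or>
    w 2 + 1 = w 3 \<and> w 3 = w 4 \<and> w 4 = w 5 + 1 \<and> w 1 = 0 \<and> w 6 = 0"
  unfolding buchsbaum_shape_def weight_indices
  by (simp add: insert_Diff_if del: One_nat_def) (simp only: disj_ac)

text \<open>The systems (A) to (D) are one condition read at the four vertices. In this form it is
  invariant under relabelling, so a single computation covers all three matchings.\<close>

definition dominating :: "(nat \<Rightarrow> nat) \<Rightarrow> 4 \<Rightarrow> bool" where
  "dominating w p \<longleftrightarrow> (\<forall>x y. x \<noteq> p \<longrightarrow> y \<noteq> p \<longrightarrow> x \<noteq> y \<longrightarrow>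
     edge_weight w x y \<le> edge_weight w p x + edge_weight w p y)"

lemma dominating_iff:
  assumes "{p, q, r, s} = (UNIV :: 4 set)"
  shows "dominating w p \<longleftrightarrow> edge_weight w q r \<le> edge_weight w p q + edge_weight w p r \<and>
    edge_weight w q s \<le> edge_weight w p q + edge_weight w p s \<and>
    edge_weight w r s \<le> edge_weight w p r + edge_weight w p s"
  using distinct_4[OF assms] unfolding dominating_def all_4[OF assms]
  by (auto simp: edge_weight_commute[of w s r] edge_weight_commute[of w s q]
      edge_weight_commute[of w r q] add.commute)

lemma system_iff_dominating:
  "system_A w \<longleftrightarrow> dominating w 0" "system_B w \<longleftrightarrow> dominating w 1"
  "system_C w \<longleftrightarrow> dominating w 2" "system_D w \<longleftrightarrow> dominating w 3"
proof -
  have U: "{0, 1, 2, 3} = (UNIV :: 4 set)" "{1, 0, 2, 3} = (UNIV :: 4 set)"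
    "{2, 0, 1, 3} = (UNIV :: 4 set)" "{3, 0, 1, 2} = (UNIV :: 4 set)"
    unfolding UNIV_4 by blast+
  show "system_A w \<longleftrightarrow> dominating w 0"
    unfolding dominating_iff[OF U(1)] system_A_def edge_weight_simps by simp
  show "system_B w \<longleftrightarrow> dominating w 1"
    unfolding dominating_iff[OF U(2)] system_B_def edge_weight_simps by auto
  show "system_C w \<longleftrightarrow> dominating w 2"
    unfolding dominating_iff[OF U(3)] system_C_def edge_weight_simps by auto
  show "system_D w \<longleftrightarrow> dominating w 3"
    unfolding dominating_iff[OF U(4)] system_D_def edge_weight_simps by auto
qed

lemma weights_of_isolated_matching:
  assumes U: "{p, q, r, s} = UNIV" and nonneg: "\<And>v. 0 \<le> \<alpha> v"
    and matching: "matching_violated w \<alpha> p q r s"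
    and up: "\<And>v. \<not> critical w (\<alpha>(v := \<alpha> v + 1))" and down: "\<And>v. \<not> critical w (\<alpha>(v := \<alpha> v - 1))"
    and minimal: "\<And>v. \<not> dominating w v"
  shows "edge_weight w p q = edge_weight w r s \<and>
    (edge_weight w p r = edge_weight w q s \<and> edge_weight w p r + 1 = edge_weight w p q \<and>
       edge_weight w p s = 0 \<and> edge_weight w q r = 0 \<or>
     edge_weight w p s = edge_weight w q r \<and> edge_weight w p s + 1 = edge_weight w p q \<and>
       edge_weight w p r = 0 \<and> edge_weight w q s = 0)"
proof -
  let ?W = "\<lambda>x y. int (edge_weight w x y)"
  have ne: "p \<noteq> q" "p \<noteq> r" "p \<noteq> s" "q \<noteq> r" "q \<noteq> s" "r \<noteq> s"
      "q \<noteq> p" "r \<noteq> p" "s \<noteq> p" "r \<noteq> q" "s \<noteq> q" "s \<noteq> r"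
    using distinct_4[OF U] by auto
  have m: "\<alpha> p + \<alpha> q < ?W p q" "\<alpha> r + \<alpha> s < ?W r s" "?W p r \<le> \<alpha> p + \<alpha> r" "?W p s \<le> \<alpha> p + \<alpha> s"
      "?W q r \<le> \<alpha> q + \<alpha> r" "?W q s \<le> \<alpha> q + \<alpha> s"
    using matching by (simp_all add: matching_violated_def)
  note n = nonneg[of p] nonneg[of q] nonneg[of r] nonneg[of s]
  \<comment> \<open>Otherwise the sum on pq is at least two below its weight. Raising
    \<open>\<alpha> p\<close> by one then leaves pq violated, does not touch rs and only helps the
    cross edges, so a neighbour would be critical.\<close>
  have pq: "\<alpha> p + \<alpha> q + 1 = ?W p q"
  proof (rule ccontr)
    assume "\<alpha> p + \<alpha> q + 1 \<noteq> ?W p q"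
    then have "critical w (\<alpha>(p := \<alpha> p + 1))"
      by (intro criticalI[OF U]) (use m n ne in simp_all)
    then show False using up by blast
  qed
  have rs: "\<alpha> r + \<alpha> s + 1 = ?W r s"
  proof (rule ccontr)
    assume "\<alpha> r + \<alpha> s + 1 \<noteq> ?W r s"
    then have "critical w (\<alpha>(r := \<alpha> r + 1))"
      by (intro criticalI[OF U]) (use m n ne in simp_all)
    then show False using up by blast
  qed
  \<comment> \<open>If a coordinate is positive and both cross edges at it have slack, lowering it
    by one keeps nonnegativity and the cross inequalities, and a smaller sum only strengthens the
    violation. Again a neighbour would be critical.\<close>
  have tight: "\<alpha> p = 0 \<or> \<alpha> p + \<alpha> r = ?W p r \<or> \<alpha> p + \<alpha> s = ?W p s"
      "\<alpha> q = 0 \<or> \<alpha> q + \<alpha> r = ?W q r \<or> \<alpha> q + \<alpha> s = ?W q s"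
      "\<alpha> r = 0 \<or> \<alpha> p + \<alpha> r = ?W p r \<or> \<alpha> q + \<alpha> r = ?W q r"
      "\<alpha> s = 0 \<or> \<alpha> p + \<alpha> s = ?W p s \<or> \<alpha> q + \<alpha> s = ?W q s"
  proof -
    show "\<alpha> p = 0 \<or> \<alpha> p + \<alpha> r = ?W p r \<or> \<alpha> p + \<alpha> s = ?W p s"
    proof (rule ccontr)
      assume "\<not> ?thesis"
      then have "critical w (\<alpha>(p := \<alpha> p - 1))"
        by (intro criticalI[OF U]) (use m n ne in simp_all)
      then show False using down by blast
    qed
    show "\<alpha> q = 0 \<or> \<alpha> q + \<alpha> r = ?W q r \<or> \<alpha> q + \<alpha> s = ?W q s"
    proof (rule ccontr)
      assume "\<not> ?thesis"
      then have "critical w (\<alpha>(q := \<alpha> q - 1))"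
        by (intro criticalI[OF U]) (use m n ne in simp_all)
      then show False using down by blast
    qed
    show "\<alpha> r = 0 \<or> \<alpha> p + \<alpha> r = ?W p r \<or> \<alpha> q + \<alpha> r = ?W q r"
    proof (rule ccontr)
      assume "\<not> ?thesis"
      then have "critical w (\<alpha>(r := \<alpha> r - 1))"
        by (intro criticalI[OF U]) (use m n ne in simp_all)
      then show False using down by blast
    qed
    show "\<alpha> s = 0 \<or> \<alpha> p + \<alpha> s = ?W p s \<or> \<alpha> q + \<alpha> s = ?W q s"
    proof (rule ccontr)
      assume "\<not> ?thesis"
      then have "critical w (\<alpha>(s := \<alpha> s - 1))"
        by (intro criticalI[OF U]) (use m n ne in simp_all)
      then show False using down by blast
    qed
  qed
  have perms: "{q, p, r, s} = UNIV" "{r, p, q, s} = UNIV" "{s, p, q, r} = UNIV"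
    unfolding U[symmetric] by blast+
  have systems: "\<not> (?W q r \<le> ?W p q + ?W p r \<and> ?W q s \<le> ?W p q + ?W p s \<and> ?W r s \<le> ?W p r + ?W p s)"
      "\<not> (?W p r \<le> ?W p q + ?W q r \<and> ?W p s \<le> ?W p q + ?W q s \<and> ?W r s \<le> ?W q r + ?W q s)"
      "\<not> (?W p q \<le> ?W p r + ?W q r \<and> ?W p s \<le> ?W p r + ?W r s \<and> ?W q s \<le> ?W q r + ?W r s)"
      "\<not> (?W p q \<le> ?W p s + ?W q s \<and> ?W p r \<le> ?W p s + ?W r s \<and> ?W q r \<le> ?W q s + ?W r s)"
    using minimal[of p] minimal[of q] minimal[of r] minimal[of s]
    unfolding dominating_iff[OF U] dominating_iff[OF perms(1)] dominating_iff[OF perms(2)]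
      dominating_iff[OF perms(3)] edge_weight_commute[of w q p] edge_weight_commute[of w r p]
      edge_weight_commute[of w r q] edge_weight_commute[of w s p] edge_weight_commute[of w s q]
      edge_weight_commute[of w s r] of_nat_add[symmetric] of_nat_le_iff
    by blast+
  have "?W p q = ?W r s \<and>
      (?W p r = ?W q s \<and> ?W p r + 1 = ?W p q \<and> ?W p s = 0 \<and> ?W q r = 0 \<or>
       ?W p s = ?W q r \<and> ?W p s + 1 = ?W p q \<and> ?W p r = 0 \<and> ?W q s = 0)"
    by (rule isolated_matching_shape[OF n _ _ _ _ _ _ pq rs m(3-6) tight systems]) simp_all
  then show ?thesis by linarith
qed

lemma shape_of_isolated_critical:
  assumes minimal: "S_minimal w" and crit: "critical w \<alpha>"
    and isolated: "\<And>\<alpha> v. critical w \<alpha> \<Longrightarrow> \<not> critical w (\<alpha>(v := \<alpha> v + 1))"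
  shows "buchsbaum_shape w"
proof -
  have up: "\<not> critical w (\<alpha>(v := \<alpha> v + 1))" for v
    using isolated crit by blast
  \<comment> \<open>Raising coordinate v of the lowered multidegree returns to \<alpha>, so
    isolation also excludes the neighbours below.\<close>
  have down: "\<not> critical w (\<alpha>(v := \<alpha> v - 1))" for v
    using isolated[of "\<alpha>(v := \<alpha> v - 1)" v] crit by auto
  \<comment> \<open>Every perfect matching contains an edge at vertex 0, and a violated edge has
    positive weight. This rules out the trivial curve, the other alternative in
    S-minimality.\<close>
  have "w 1 \<noteq> 0 \<or> w 2 \<noteq> 0 \<or> w 3 \<noteq> 0"
    using crit unfolding critical_iff by auto
  then have "\<not> system_A w \<and> \<not> system_B w \<and> \<not> system_C w \<and> \<not> system_D w"
    using minimal unfolding S_minimal_def weight_indices by auto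
  then have "\<forall>v. \<not> dominating w v"
    unfolding system_iff_dominating all_4[OF UNIV_4[symmetric]] by blast
  then have vertices: "\<not> dominating w v" for v by blast
  have nonneg: "0 \<le> \<alpha> v" for v
    using crit unfolding critical_iff_matching by blast
  note weights = weights_of_isolated_matching[OF _ nonneg _ up down vertices]
  have U: "{0, 1, 2, 3} = (UNIV :: 4 set)" "{0, 2, 1, 3} = (UNIV :: 4 set)"
      "{0, 3, 1, 2} = (UNIV :: 4 set)"
    unfolding UNIV_4 by blast+
  consider "matching_violated w \<alpha> 0 1 2 3" | "matching_violated w \<alpha> 0 2 1 3"
    | "matching_violated w \<alpha> 0 3 1 2"
    using crit unfolding critical_iff_matching by blast
  then show ?thesis
  proof cases
    case 1
    from weights[OF U(1) 1, unfolded edge_weight_simps] show ?thesis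
      unfolding buchsbaum_shape_iff by (elim conjE disjE) simp_all
  next
    case 2
    from weights[OF U(2) 2, unfolded edge_weight_simps] show ?thesis
      unfolding buchsbaum_shape_iff by (elim conjE disjE) simp_all
  next
    case 3
    from weights[OF U(3) 3, unfolded edge_weight_simps] show ?thesis
      unfolding buchsbaum_shape_iff by (elim conjE disjE) simp_all
  qed
qed

section \<open>Critical multidegrees of the stated weights\<close>

lemma buchsbaum_shape_cases:
  assumes "buchsbaum_shape w"
  obtains n where "w 1 = n + 1" "w 2 = n" "w 3 = 0" "w 4 = 0" "w 5 = n" "w 6 = n + 1"
  | n where "w 1 = n + 1" "w 2 = 0" "w 3 = n" "w 4 = n" "w 5 = 0" "w 6 = n + 1"
  | n where "w 1 = n" "w 2 = n + 1" "w 3 = 0" "w 4 = 0" "w 5 = n + 1" "w 6 = n"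
  | n where "w 1 = 0" "w 2 = n + 1" "w 3 = n" "w 4 = n" "w 5 = n + 1" "w 6 = 0"
  | n where "w 1 = n" "w 2 = 0" "w 3 = n + 1" "w 4 = n + 1" "w 5 = 0" "w 6 = n"
  | n where "w 1 = 0" "w 2 = n" "w 3 = n + 1" "w 4 = n + 1" "w 5 = n" "w 6 = 0"
  using assms unfolding buchsbaum_shape_iff
  apply (elim disjE conjE)
  subgoal by (rule that(1)[of "w 2"]; linarith)
  subgoal by (rule that(2)[of "w 3"]; linarith)
  subgoal by (rule that(3)[of "w 1"]; linarith)
  subgoal by (rule that(4)[of "w 3"]; linarith)
  subgoal by (rule that(5)[of "w 1"]; linarith)
  subgoal by (rule that(6)[of "w 2"]; linarith)
  done

text \<open>The witness has n at both ends of an edge of weight 0. Each edge outside the matching of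
  that edge has exactly one end there and gets the sum n: one short of the weight n + 1, and just
  enough for the weight n.\<close>

lemma critical_exists_of_shape:
  assumes "buchsbaum_shape w"
  shows "\<exists>\<alpha>. critical w \<alpha>"
proof -
  define vec :: "int \<Rightarrow> int \<Rightarrow> int \<Rightarrow> int \<Rightarrow> 4 \<Rightarrow> int"
    where "vec x y z t = (\<lambda>v. 0)(0 := x, 1 := y, 2 := z, 3 := t)" for x y z t
  have vec: "vec x y z t 0 = x" "vec x y z t 1 = y" "vec x y z t 2 = z" "vec x y z t 3 = t" for x y z t
    by (simp_all add: vec_def)
  from assms show ?thesis
  proof (cases rule: buchsbaum_shape_cases)
    case (1 n)
    then have "critical w (vec n 0 0 n)" by (simp only: critical_iff vec) simp
    then show ?thesis by blast
  next
    case (2 n)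
    then have "critical w (vec n 0 n 0)" by (simp only: critical_iff vec) simp
    then show ?thesis by blast
  next
    case (3 n)
    then have "critical w (vec n 0 0 n)" by (simp only: critical_iff vec) simp
    then show ?thesis by blast
  next
    case (4 n)
    then have "critical w (vec n n 0 0)" by (simp only: critical_iff vec) simp
    then show ?thesis by blast
  next
    case (5 n)
    then have "critical w (vec n 0 n 0)" by (simp only: critical_iff vec) simp
    then show ?thesis by blast
  next
    case (6 n)
    then have "critical w (vec n n 0 0)" by (simp only: critical_iff vec) simp
    then show ?thesis by blast
  qed
qed

text \<open>The violated edges must be those of weight n + 1: weight 0 cannot be violated, and
  violating the edges of weight n would need a degree both at most 2n - 2 and at least 2n + 2.
  Violation of the weights n + 1 bounds the degree above by 2n, and the weights n bound it below by
  2n. Writing it through the total weight 4n + 2 avoids the n hidden in the case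
  distinction.\<close>

lemma critical_degree_of_shape:
  assumes "buchsbaum_shape w" "critical w \<alpha>"
  shows "2 * (\<alpha> 0 + \<alpha> 1 + \<alpha> 2 + \<alpha> 3) = int (w 1 + w 2 + w 3 + w 4 + w 5 + w 6) - 2"
  using assms(1)
proof (cases rule: buchsbaum_shape_cases)
  case (1 n)
  then show ?thesis
    using assms(2) unfolding critical_iff 1 by (elim conjE disjE) simp_all
next
  case (2 n)
  then show ?thesis
    using assms(2) unfolding critical_iff 2 by (elim conjE disjE) simp_all
next
  case (3 n)
  then show ?thesis
    using assms(2) unfolding critical_iff 3 by (elim conjE disjE) simp_all
next
  case (4 n)
  then show ?thesis
    using assms(2) unfolding critical_iff 4 by (elim conjE disjE) simp_all
next
  case (5 n)
  then show ?thesis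
    using assms(2) unfolding critical_iff 5 by (elim conjE disjE) simp_all
next
  case (6 n)
  then show ?thesis
    using assms(2) unfolding critical_iff 6 by (elim conjE disjE) simp_all
qed

text \<open>There may be several critical multidegrees, but they all share one degree, whereas
  neighbours differ in degree by one.\<close>

lemma isolated_of_shape:
  assumes "buchsbaum_shape w" "critical w \<alpha>"
  shows "\<not> critical w (\<alpha>(v := \<alpha> v + 1))"
proof
  assume "critical w (\<alpha>(v := \<alpha> v + 1))"
  note degree = critical_degree_of_shape[OF assms] critical_degree_of_shape[OF assms(1) this]
  have sum_4: "(\<Sum>u\<in>UNIV. \<beta> u) = \<beta> 0 + \<beta> 1 + \<beta> 2 + \<beta> 3" for \<beta> :: "4 \<Rightarrow> int"
    unfolding UNIV_4 by simp
  have "(\<Sum>u\<in>UNIV. \<alpha> u) = (\<Sum>u\<in>UNIV. (\<alpha>(v := \<alpha> v + 1)) u) - 1"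
    using sum_fun_upd_minus_one[of "\<alpha>(v := \<alpha> v + 1)" v]
    by (simp only: fun_upd_same fun_upd_upd add_diff_cancel_right' fun_upd_triv)
  note step = this[unfolded sum_4]
  have "x \<noteq> y - 1" if "2 * x = c" "2 * y = c" for x y c :: int
    using that by simp
  from this[OF degree] step show False ..
qed

theorem corollary5p4:
  fixes w :: "nat \<Rightarrow> nat" and C :: "'k::field ring4 set"
  assumes "C = tetrahedral_ideal w"
    and "S_minimal w"
  shows "(arithmetically_Buchsbaum C \<and> \<not> arithmetically_CM C) \<longleftrightarrow>
    (\<exists>i\<in>{1, 2, 3}. \<exists>j\<in>{1, 2, 3}. i \<noteq> j \<and>
       w i + 1 = w j \<and> w j = w (7 - j) \<and> w (7 - j) = w (7 - i) + 1 \<and>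
       (\<forall>l \<in> {1..6} - {i, j, 7 - i, 7 - j}. w l = 0))"
  unfolding buchsbaum_shape_def[symmetric] assms(1)
    arithmetically_CM_iff_no_critical arithmetically_Buchsbaum_iff_isolated
  using shape_of_isolated_critical[OF assms(2)] critical_exists_of_shape isolated_of_shape
  by blast

end
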